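(* Let $r\ge 1$ and fix a partition $\sigma=(r_1,\overset{(a_1)}{\ldots},r_1,\ldots,r_s,\overset{(a_s)}{\ldots},r_s)$ of $r$. The fibration $$\mathrm{SSym}^r_\sigma(S^1\times S^1)\to\mathrm{SSym}^r_\sigma(S^1),\qquad \{(\lambda_1,\mu_1),\dots,(\lambda_r,\mu_r)\}\mapsto\{\lambda_1,\dots,\lambda_r\},$$ is Zariski locally trivial with fiber $\mathrm{SSym}^\sigma(S^1)$.
   Context: $S^1\subset\mathbb{C}$ is the unit circle and $\mathrm{Sym}^r(X)=X^r/S_r$ is the symmetric product, where the symmetric group $S_r$ permutes the factors. A partition $\sigma$ as in the claim satisfies $r=a_1r_1+\cdots+a_sr_s$ with $r_1>\cdots>r_s>0$ and $a_i\ge 0$. $\mathrm{SSym}^r_\sigma(S^1)$ is the set of $\{\lambda_1,\dots,\lambda_r\}\in\mathrm{Sym}^r(S^1)$ with $\lambda_1\cdots\lambda_r=1$ whose coincident entries are given by $\sigma$, i.e. exactly $a_i$ distinct values occur with multiplicity $r_i$, for $i=1,\dots,s$. $\mathrm{SSym}^r_\sigma(S^1\times S^1)$ is the set of $\{(\lambda_1,\mu_1),\dots,(\lambda_r,\mu_r)\}\in\mathrm{Sym}^r(S^1\times S^1)$ with $\lambda_1\cdots\lambda_r=\mu_1\cdots\mu_r=1$ and $\{\lambda_1,\dots,\lambda_r\}\in\mathrm{SSym}^r_\sigma(S^1)$. Let $S_\sigma=S_{r_1}^{a_1}\times\cdots\times S_{r_s}^{a_s}<S_r$ be the subgroup of permutations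 of type $\sigma$ (permuting entries inside consecutive blocks of sizes given by $\sigma$); then $\mathrm{Sym}^\sigma(S^1)=(S^1)^r/S_\sigma$, and $\mathrm{SSym}^\sigma(S^1)\subset\mathrm{Sym}^\sigma(S^1)$ is the subset of configurations $\{\mu_1,\dots,\mu_r\}$ with $\mu_1\cdots\mu_r=1$. *)

theory Defs
  imports "HOL-Analysis.Analysis"
begin

section \<open>Quotients of configuration spaces\<close>

definition quotient_topology :: "'t topology \<Rightarrow> ('t \<Rightarrow> 'q) \<Rightarrow> 'q topology" where
  "quotient_topology T q =
     topology (\<lambda>U. U \<subseteq> q ` topspace T \<and> openin T {x \<in> topspace T. q x \<in> U})"

lemma openin_quotient_topology:
  "openin (quotient_topology T q) U \<longleftrightarrow>
     U \<subseteq> q ` topspace T \<and> openin T {x \<in> topspace T. q x \<in> U}"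
proof -
  have "istopology (\<lambda>U. U \<subseteq> q ` topspace T \<and> openin T {x \<in> topspace T. q x \<in> U})"
    unfolding istopology_def
  proof (intro conjI allI impI)
    fix S U
    assume S: "S \<subseteq> q ` topspace T \<and> openin T {x \<in> topspace T. q x \<in> S}"
      and U: "U \<subseteq> q ` topspace T \<and> openin T {x \<in> topspace T. q x \<in> U}"
    show "S \<inter> U \<subseteq> q ` topspace T" using S by blast
    have "{x \<in> topspace T. q x \<in> S \<inter> U} =
          {x \<in> topspace T. q x \<in> S} \<inter> {x \<in> topspace T. q x \<in> U}" by blast
    then show "openin T {x \<in> topspace T. q x \<in> S \<inter> U}" using S U by (simp only: openin_Int)
  next
    fix \<U>
    assume *: "\<forall>U\<in>\<U>. U \<subseteq> q ` topspace T \<and> openin T {x \<in> topspace T. q x \<in> U}"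
    then show "\<Union>\<U> \<subseteq> q ` topspace T" by blast
    have "{x \<in> topspace T. q x \<in> \<Union>\<U>} = (\<Union>U\<in>\<U>. {x \<in> topspace T. q x \<in> U})" by blast
    then show "openin T {x \<in> topspace T. q x \<in> \<Union>\<U>}"
      using * by (simp only:) (rule openin_Union, blast)
  qed
  then show ?thesis unfolding quotient_topology_def by (simp only: topology_inverse')
qed

lemma topspace_quotient_topology: "topspace (quotient_topology T q) = q ` topspace T"
proof -
  have "{x \<in> topspace T. q x \<in> q ` topspace T} = topspace T" by blast
  then have "openin (quotient_topology T q) (q ` topspace T)"
    by (simp add: openin_quotient_topology)
  then have "q ` topspace T \<subseteq> topspace (quotient_topology T q)"
    by (rule openin_subset)
  moreover have "topspace (quotient_topology T q) \<subseteq> q ` topspace T"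
    using openin_topspace[of "quotient_topology T q"] unfolding openin_quotient_topology by (rule conjunct1)
  ultimately show ?thesis by (rule subset_antisym[rotated])
qed

lemma quotient_map_quotient_topology: "quotient_map T (quotient_topology T q) q"
  unfolding quotient_map_def topspace_quotient_topology
  by (simp add: openin_quotient_topology)

text \<open>
  The spaces considered are subsets of finite quotients of subsets of some \<open>\<real>\<^sup>N\<close>. Such a space
  is presented by the space \<open>reps\<close> upstairs with its Euclidean topology, the coordinate functions
  \<open>coords\<close> that embed it into \<open>\<real>\<^sup>N\<close>, the quotient map \<open>cls\<close>, and the set \<open>points\<close> of those
  classes that belong to the space.
\<close>

record ('t, 'q) quot_space =
  reps :: "'t topology"
  coords :: "('t \<Rightarrow> real) set"
  cls :: "'t \<Rightarrow> 'q"
  points :: "'q set"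

text \<open>The real polynomial functions in a given set of coordinate functions.\<close>

inductive_set polynomials :: "('t \<Rightarrow> real) set \<Rightarrow> ('t \<Rightarrow> real) set"
  for C :: "('t \<Rightarrow> real) set" where
  coord: "c \<in> C \<Longrightarrow> c \<in> polynomials C"
| const: "(\<lambda>_. k) \<in> polynomials C"
| add: "f \<in> polynomials C \<Longrightarrow> g \<in> polynomials C \<Longrightarrow> (\<lambda>x. f x + g x) \<in> polynomials C"
| mult: "f \<in> polynomials C \<Longrightarrow> g \<in> polynomials C \<Longrightarrow> (\<lambda>x. f x * g x) \<in> polynomials C"

definition zariski_reps :: "('t, 'q) quot_space \<Rightarrow> 't topology" where
  "zariski_reps S =
     topology_generated_by {{x \<in> topspace (reps S). f x \<noteq> 0} | f. f \<in> polynomials (coords S)}"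

definition euclidean_top :: "('t, 'q) quot_space \<Rightarrow> 'q topology" where
  "euclidean_top S = subtopology (quotient_topology (reps S) (cls S)) (points S)"

text \<open>
  For a finite group \<open>G\<close> acting linearly, the zero sets of \<open>G\<close>-invariant polynomials are exactly
  the \<open>G\<close>-invariant real algebraic sets (if the zero set of \<open>f\<close> is invariant, it is also that of
  the sum of the squares of the translates of \<open>f\<close>). Hence the Zariski topology of the quotient
  is the quotient of the Zariski topology upstairs.
\<close>

definition zariski_top :: "('t, 'q) quot_space \<Rightarrow> 'q topology" where
  "zariski_top S = subtopology (quotient_topology (zariski_reps S) (cls S)) (points S)"

definition times_space ::
    "('t, 'q) quot_space \<Rightarrow> ('u, 'p) quot_space \<Rightarrow> ('t \<times> 'u, 'q \<times> 'p) quot_space" where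
  "times_space S T = \<lparr>
     reps = prod_topology (reps S) (reps T),
     coords = (\<lambda>c. c \<circ> fst) ` coords S \<union> (\<lambda>c. c \<circ> snd) ` coords T,
     cls = map_prod (cls S) (cls T),
     points = points S \<times> points T\<rparr>"


section \<open>Semialgebraic maps and Zariski local triviality\<close>

text \<open>The Boolean algebra of subsets of \<open>W\<close> generated by polynomial inequalities.\<close>

inductive_set semialgebraic :: "'t set \<Rightarrow> ('t \<Rightarrow> real) set \<Rightarrow> 't set set"
  for W :: "'t set" and C :: "('t \<Rightarrow> real) set" where
  pos: "f \<in> polynomials C \<Longrightarrow> {x \<in> W. f x > 0} \<in> semialgebraic W C"
| diff: "A \<in> semialgebraic W C \<Longrightarrow> W - A \<in> semialgebraic W C"
| inter: "A \<in> semialgebraic W C \<Longrightarrow> B \<in> semialgebraic W C \<Longrightarrow> A \<inter> B \<in> semialgebraic W C"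

text \<open>
  A map defined on a subset \<open>D\<close> of the quotient is semialgebraic if its graph is; a subset of a
  quotient by a finite group is semialgebraic iff its preimage upstairs is (Tarski--Seidenberg).
\<close>

definition semialgebraic_map ::
    "('t, 'q) quot_space \<Rightarrow> ('u, 'p) quot_space \<Rightarrow> 'q set \<Rightarrow> ('q \<Rightarrow> 'p) \<Rightarrow> bool" where
  "semialgebraic_map S T D \<phi> \<longleftrightarrow>
     {(x, y). x \<in> topspace (reps S) \<and> y \<in> topspace (reps T) \<and> cls S x \<in> D \<and> \<phi> (cls S x) = cls T y}
       \<in> semialgebraic (topspace (reps S) \<times> topspace (reps T)) (coords (times_space S T))"

text \<open>
  Over the members of a cover of \<open>B\<close> by Zariski open sets \<open>U\<close>, the projection is isomorphic to
  \<open>U \<times> F \<rightarrow> U\<close>. Quotients of real algebraic sets by finite groups are in general only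
  semialgebraic sets, so the isomorphisms are semialgebraic homeomorphisms over \<open>U\<close>. The inverse
  of such a homeomorphism is semialgebraic too, its graph being the same up to a swap.
\<close>

definition zariski_locally_trivial ::
    "('e, 'p) quot_space \<Rightarrow> ('b, 'q) quot_space \<Rightarrow> ('f, 'v) quot_space \<Rightarrow> ('p \<Rightarrow> 'q) \<Rightarrow> bool" where
  "zariski_locally_trivial E B F proj \<longleftrightarrow>
     continuous_map (euclidean_top E) (euclidean_top B) proj \<and>
     (\<forall>b \<in> points B. \<exists>U \<phi>. openin (zariski_top B) U \<and> b \<in> U \<and>
        (let D = {e \<in> points E. proj e \<in> U} in
           homeomorphic_map (subtopology (euclidean_top E) D)
             (prod_topology (subtopology (euclidean_top B) U) (euclidean_top F)) \<phi> \<and>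
           semialgebraic_map E (times_space B F) D \<phi> \<and>
           (\<forall>e \<in> D. fst (\<phi> e) = proj e)))"


section \<open>Symmetric products\<close>

text \<open>
  \<open>X\<^sup>r\<close> consists of the extensional functions from \<open>{..<r}\<close> to \<open>X\<close>, and a point of \<open>X\<^sup>r / G\<close> is an
  orbit. The symmetric group on \<open>r\<close> letters is \<open>{\<pi>. \<pi> permutes {..<r}}\<close>.
\<close>

definition orbit :: "(nat \<Rightarrow> nat) set \<Rightarrow> nat \<Rightarrow> (nat \<Rightarrow> 'a) \<Rightarrow> (nat \<Rightarrow> 'a) set" where
  "orbit G r x = (\<lambda>\<pi>. \<lambda>j\<in>{..<r}. x (\<pi> j)) ` G"

definition Sym :: "(nat \<Rightarrow> nat) set \<Rightarrow> nat \<Rightarrow> 'a::euclidean_space set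
    \<Rightarrow> (nat \<Rightarrow> 'a, (nat \<Rightarrow> 'a) set) quot_space" where
  "Sym G r X = \<lparr>
     reps = product_topology (\<lambda>_. top_of_set X) {..<r},
     coords = {\<lambda>x. x j \<bullet> b | j b. j < r \<and> b \<in> Basis},
     cls = orbit G r,
     points = orbit G r ` ({..<r} \<rightarrow>\<^sub>E X)\<rparr>"

abbreviation symmetric_group :: "nat \<Rightarrow> (nat \<Rightarrow> nat) set" where
  "symmetric_group r \<equiv> {\<pi>. \<pi> permutes {..<r}}"

abbreviation unit_circle :: "complex set" where
  "unit_circle \<equiv> sphere 0 1"


section \<open>Configurations of a given type\<close>

text \<open>
  A partition of \<open>r\<close> in which the part \<open>\<rho> i\<close> occurs \<open>a i\<close> times, for \<open>i = 1, \<dots>, s\<close>.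
\<close>

definition partition_type :: "nat \<Rightarrow> nat \<Rightarrow> (nat \<Rightarrow> nat) \<Rightarrow> (nat \<Rightarrow> nat) \<Rightarrow> bool" where
  "partition_type r s a \<rho> \<longleftrightarrow>
     (\<forall>i\<in>{1..s}. \<forall>j\<in>{1..s}. i < j \<longrightarrow> \<rho> i > \<rho> j) \<and>
     (\<forall>i\<in>{1..s}. \<rho> i > 0) \<and>
     r = (\<Sum>i=1..s. a i * \<rho> i)"

text \<open>The \<open>k\<close>-th of the \<open>a i\<close> consecutive blocks of size \<open>\<rho> i\<close>, counting \<open>k\<close> from 0.\<close>

definition block :: "(nat \<Rightarrow> nat) \<Rightarrow> (nat \<Rightarrow> nat) \<Rightarrow> nat \<Rightarrow> nat \<Rightarrow> nat set" where
  "block a \<rho> i k =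
     (let m = (\<Sum>l=1..<i. a l * \<rho> l) + k * \<rho> i in {m..<m + \<rho> i})"

definition young_subgroup :: "nat \<Rightarrow> nat \<Rightarrow> (nat \<Rightarrow> nat) \<Rightarrow> (nat \<Rightarrow> nat) \<Rightarrow> (nat \<Rightarrow> nat) set" where
  "young_subgroup r s a \<rho> =
     {\<pi> \<in> symmetric_group r. \<forall>i\<in>{1..s}. \<forall>k<a i. \<pi> ` block a \<rho> i k = block a \<rho> i k}"

definition coincidences_given_by ::
    "nat \<Rightarrow> nat \<Rightarrow> (nat \<Rightarrow> nat) \<Rightarrow> (nat \<Rightarrow> nat) \<Rightarrow> (nat \<Rightarrow> 'a) \<Rightarrow> bool" where
  "coincidences_given_by r s a \<rho> x \<longleftrightarrow>
     (\<forall>i\<in>{1..s}. card {z. card {j. j < r \<and> x j = z} = \<rho> i} = a i)"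

definition SSym_circle :: "nat \<Rightarrow> nat \<Rightarrow> (nat \<Rightarrow> nat) \<Rightarrow> (nat \<Rightarrow> nat)
    \<Rightarrow> (nat \<Rightarrow> complex, (nat \<Rightarrow> complex) set) quot_space" where
  "SSym_circle r s a \<rho> = (Sym (symmetric_group r) r unit_circle)
     \<lparr>points := orbit (symmetric_group r) r `
        {x \<in> {..<r} \<rightarrow>\<^sub>E unit_circle. (\<Prod>j<r. x j) = 1 \<and> coincidences_given_by r s a \<rho> x}\<rparr>"

definition SSym_torus :: "nat \<Rightarrow> nat \<Rightarrow> (nat \<Rightarrow> nat) \<Rightarrow> (nat \<Rightarrow> nat)
    \<Rightarrow> (nat \<Rightarrow> complex \<times> complex, (nat \<Rightarrow> complex \<times> complex) set) quot_space" where
  "SSym_torus r s a \<rho> = (Sym (symmetric_group r) r (unit_circle \<times> unit_circle))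
     \<lparr>points := orbit (symmetric_group r) r `
        {x \<in> {..<r} \<rightarrow>\<^sub>E unit_circle \<times> unit_circle.
           (\<Prod>j<r. fst (x j)) = 1 \<and> (\<Prod>j<r. snd (x j)) = 1 \<and>
           orbit (symmetric_group r) r (\<lambda>j\<in>{..<r}. fst (x j)) \<in> points (SSym_circle r s a \<rho>)}\<rparr>"

definition SSym_fibre :: "nat \<Rightarrow> nat \<Rightarrow> (nat \<Rightarrow> nat) \<Rightarrow> (nat \<Rightarrow> nat)
    \<Rightarrow> (nat \<Rightarrow> complex, (nat \<Rightarrow> complex) set) quot_space" where
  "SSym_fibre r s a \<rho> = (Sym (young_subgroup r s a \<rho>) r unit_circle)
     \<lparr>points := orbit (young_subgroup r s a \<rho>) r `
        {y \<in> {..<r} \<rightarrow>\<^sub>E unit_circle. (\<Prod>j<r. y j) = 1}\<rparr>"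

definition forget_snd :: "nat \<Rightarrow> (nat \<Rightarrow> 'a \<times> 'b) set \<Rightarrow> (nat \<Rightarrow> 'a) set" where
  "forget_snd r c = (\<lambda>x. \<lambda>j\<in>{..<r}. fst (x j)) ` c"

lemma forget_snd_orbit:
  "forget_snd r (orbit (symmetric_group r) r x) =
   orbit (symmetric_group r) r (\<lambda>j\<in>{..<r}. fst (x j))"
proof -
  have "(\<lambda>j\<in>{..<r}. fst ((\<lambda>j\<in>{..<r}. x (\<pi> j)) j)) =
        (\<lambda>j\<in>{..<r}. (\<lambda>j\<in>{..<r}. fst (x j)) (\<pi> j))" if "\<pi> permutes {..<r}" for \<pi>
    using permutes_in_image[OF that] by (auto simp: restrict_def fun_eq_iff)
  then show ?thesis
    unfolding forget_snd_def orbit_def image_image by (intro image_cong) auto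
qed

end

theory Submission
  imports Defs
begin

text \<open>
  Write \<open>S\<^sub>\<sigma>\<close> for the subgroup \<open>young_subgroup\<close> of the permutations of type \<open>\<sigma>\<close>. The idea is
  to order the points of a configuration. A circle that is cut at a point \<open>p\<close> becomes a line, so that the points of a configuration
  \<open>{\<lambda>\<^sub>1, \<dots>, \<lambda>\<^sub>r}\<close> of type \<open>\<sigma>\<close> avoiding \<open>p\<close> can be listed canonically: first by decreasing
  multiplicity, as the blocks of \<open>\<sigma>\<close> prescribe, and then, among the points with the same
  multiplicity, by their position on the line. This is the \<^emph>\<open>normal form\<close> of the configuration. Among
  the rearrangements of a tuple, those that keep a normal form normal are exactly the ones that
  permute within the blocks (\<open>normal_permute_imp_Young\<close>, \<open>permute_Young_normal\<close>), and every
  tuple of type \<open>\<sigma>\<close> avoiding \<open>p\<close> has a normal rearrangement (\<open>ex_permute_normal\<close>).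

  Consequently, once the \<open>\<lambda>\<close>s of a configuration of pairs \<open>(\<lambda>\<^sub>j, \<mu>\<^sub>j)\<close> are put into normal form, the
  tuple of the \<open>\<mu>\<close>s is determined exactly up to \<open>S\<^sub>\<sigma>\<close>. Over the set
  \<open>chart p\<close> of the configurations that avoid \<open>p\<close>, this identifies the total space with
  the product of \<open>chart p\<close> and the fibre (\<open>assemble_trivialisation\<close>, \<open>trivialisation_assemble\<close>).
  The chart is Zariski open, because it is defined by \<open>\<Prod>\<^sub>j \<bar>\<lambda>\<^sub>j - p\<bar>\<^sup>2 \<noteq> 0\<close>, and the charts cover the
  base, because a finite set does not exhaust the circle.

  Continuity in both directions rests on one observation (\<open>closedin_normal\<close>): among the tuples of
  type \<open>\<sigma>\<close> avoiding \<open>p\<close>, those that a given permutation brings into normal form are a closed set.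
  Indeed, the equalities and the weak inequalities alone characterise them, since the number of
  distinct entries is prescribed by \<open>\<sigma>\<close>. So the space upstairs is covered by finitely many closed
  sets on each of which the trivialisation, or its inverse, is given by one permutation of the
  coordinates, and it descends through the quotient maps, which are open. The order on
  the cut circle is that of the coordinate \<open>cot (\<theta> / 2)\<close>, a rational function, so the normal form is
  described by finitely many polynomial conditions. Therefore the graph of the
  trivialisation is semialgebraic.
\<close>

section \<open>Permuting the entries of a configuration\<close>

text \<open>
  The right action of permutations on tuples. Applying \<open>\<pi>\<close> and then \<open>\<tau>\<close> is therefore applying
  \<open>\<pi> \<circ> \<tau>\<close>.
\<close>

definition permute :: "nat \<Rightarrow> (nat \<Rightarrow> nat) \<Rightarrow> (nat \<Rightarrow> 'a) \<Rightarrow> nat \<Rightarrow> 'a" where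
  "permute r \<pi> x = (\<lambda>j\<in>{..<r}. x (\<pi> j))"

lemma permute_apply: "j < r \<Longrightarrow> permute r \<pi> x j = x (\<pi> j)"
  by (simp add: permute_def)

lemma permutes_less: "\<pi> permutes {..<r} \<Longrightarrow> \<pi> j < r \<longleftrightarrow> j < (r::nat)"
  using permutes_in_image[of \<pi> "{..<r}" j] by simp

lemma permute_comp:
  "\<tau> permutes {..<r} \<Longrightarrow> permute r \<tau> (permute r \<pi> x) = permute r (\<pi> \<circ> \<tau>) x"
  by (auto simp: permute_def fun_eq_iff permutes_less)

lemma permute_id: "x \<in> {..<r} \<rightarrow>\<^sub>E X \<Longrightarrow> permute r id x = x"
  by (auto simp: permute_def PiE_def extensional_def)

lemma permute_PiE:
  "\<pi> permutes {..<r} \<Longrightarrow> x \<in> {..<r} \<rightarrow>\<^sub>E X \<Longrightarrow> permute r \<pi> x \<in> {..<r} \<rightarrow>\<^sub>E X"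
  by (auto simp: permute_def permutes_less PiE_iff)

lemma prod_permute:
  "\<pi> permutes {..<r} \<Longrightarrow> (\<Prod>j<r. f (permute r \<pi> x j)) = (\<Prod>j<r. f (x j))"
  using prod.permute[of \<pi> "{..<r}" "\<lambda>j. f (x j)"] by (simp add: permute_apply)

definition occurrences :: "nat \<Rightarrow> (nat \<Rightarrow> 'a) \<Rightarrow> 'a \<Rightarrow> nat" where
  "occurrences r x z = card {j. j < r \<and> x j = z}"

lemma occurrences_pos_iff: "occurrences r x z > 0 \<longleftrightarrow> z \<in> x ` {..<r}"
  by (auto simp: occurrences_def card_gt_0_iff)

lemma occurrences_permute:
  assumes "\<pi> permutes {..<r}"
  shows "occurrences r (permute r \<pi> x) z = occurrences r x z"
proof -
  have "{j. j < r \<and> x j = z} = \<pi> ` {j. j < r \<and> permute r \<pi> x j = z}"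
  proof (intro set_eqI iffI)
    fix j assume j: "j \<in> {j. j < r \<and> x j = z}"
    then obtain i where "i < r" "j = \<pi> i"
      using permutes_image[OF assms] by (metis (no_types, lifting) imageE lessThan_iff mem_Collect_eq)
    then show "j \<in> \<pi> ` {j. j < r \<and> permute r \<pi> x j = z}" using j by (auto simp: permute_apply)
  qed (auto simp: permute_apply permutes_less[OF assms])
  then show ?thesis
    unfolding occurrences_def using card_image[OF permutes_inj_on[OF assms]] by metis
qed

lemma coincidences_given_by_occurrences:
  "coincidences_given_by r s a \<rho> x \<longleftrightarrow> (\<forall>i\<in>{1..s}. card {z. occurrences r x z = \<rho> i} = a i)"
  by (simp add: coincidences_given_by_def occurrences_def)

lemma image_permute:
  assumes "\<pi> permutes {..<r}"
  shows "permute r \<pi> x ` {..<r} = x ` {..<r}"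
proof -
  have "permute r \<pi> x ` {..<r} = x ` \<pi> ` {..<r}"
    unfolding image_image by (intro image_cong) (auto simp: permute_apply)
  then show ?thesis by (simp add: permutes_image[OF assms])
qed

lemma orbit_permute: "orbit G r x = (\<lambda>\<pi>. permute r \<pi> x) ` G"
  by (simp add: orbit_def permute_def)

locale perm_group =
  fixes G :: "(nat \<Rightarrow> nat) set" and r :: nat
  assumes perms: "\<pi> \<in> G \<Longrightarrow> \<pi> permutes {..<r}"
    and id_mem: "id \<in> G"
    and comp_mem: "\<pi> \<in> G \<Longrightarrow> \<tau> \<in> G \<Longrightarrow> \<pi> \<circ> \<tau> \<in> G"
    and inv_mem: "\<pi> \<in> G \<Longrightarrow> inv \<pi> \<in> G"
begin

lemma finite_group: "finite G"
  by (rule finite_subset[of _ "{\<pi>. \<pi> permutes {..<r}}"]) (auto simp: perms finite_permutations)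

lemma orbit_refl: "x \<in> {..<r} \<rightarrow>\<^sub>E X \<Longrightarrow> x \<in> orbit G r x"
  using permute_id[of x r X] id_mem unfolding orbit_permute by (metis imageI)

lemma orbit_permute_eq:
  assumes "\<pi> \<in> G"
  shows "orbit G r (permute r \<pi> x) = orbit G r x"
proof -
  have "orbit G r (permute r \<pi> x) = (\<lambda>\<tau>. permute r \<tau> x) ` (\<lambda>\<tau>. \<pi> \<circ> \<tau>) ` G"
    unfolding orbit_permute image_image
    by (intro image_cong refl) (simp add: permute_comp perms)
  also have "(\<lambda>\<tau>. \<pi> \<circ> \<tau>) ` G = G"
  proof (intro equalityI subsetI)
    fix \<tau> assume "\<tau> \<in> G"
    moreover have "\<tau> = \<pi> \<circ> (inv \<pi> \<circ> \<tau>)"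
      using permutes_inv_o(1)[OF perms[OF assms]] by (simp add: o_assoc)
    ultimately show "\<tau> \<in> (\<lambda>\<tau>. \<pi> \<circ> \<tau>) ` G" using assms comp_mem inv_mem by blast
  qed (use assms comp_mem in blast)
  finally show ?thesis by (simp add: orbit_permute)
qed

lemma orbit_eq_iff:
  assumes "x \<in> {..<r} \<rightarrow>\<^sub>E X"
  shows "orbit G r x = orbit G r y \<longleftrightarrow> (\<exists>\<pi>\<in>G. x = permute r \<pi> y)"
proof
  assume "orbit G r x = orbit G r y"
  then show "\<exists>\<pi>\<in>G. x = permute r \<pi> y"
    using orbit_refl[OF assms] unfolding orbit_permute by blast
qed (use orbit_permute_eq in blast)

end

lemma perm_group_symmetric: "perm_group (symmetric_group r) r"
  by (rule perm_group.intro) (simp_all add: permutes_id permutes_compose permutes_inv del: id_apply)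

section \<open>Normal form of a configuration\<close>

text \<open>
  Two labellings of a finite set that use every label equally often differ by a permutation: match
  the elements with a given label in any way.
\<close>

lemma ex_permutation_matching_labels:
  assumes fin: "finite A"
    and f: "\<And>j. j \<in> A \<Longrightarrow> f j \<in> I"
    and eq: "\<And>b. b \<in> I \<Longrightarrow> card {j\<in>A. f j = b} = card {j\<in>A. g j = b}"
  shows "\<exists>\<pi>. \<pi> permutes A \<and> (\<forall>j\<in>A. g (\<pi> j) = f j)"
proof -
  have "\<forall>b\<in>I. \<exists>h. bij_betw h {j\<in>A. f j = b} {j\<in>A. g j = b}"
    using eq fin by (intro ballI finite_same_card_bij) auto
  then obtain h where h: "\<And>b. b \<in> I \<Longrightarrow> bij_betw (h b) {j\<in>A. f j = b} {j\<in>A. g j = b}"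
    by metis
  define \<pi> where "\<pi> j = (if j \<in> A then h (f j) j else j)" for j
  have \<pi>: "\<pi> j \<in> A \<and> g (\<pi> j) = f j" if "j \<in> A" for j
    using bij_betw_apply[OF h[OF f[OF that]], of j] that by (auto simp: \<pi>_def)
  have "inj_on \<pi> A"
  proof (rule inj_onI)
    fix j j' assume *: "j \<in> A" "j' \<in> A" "\<pi> j = \<pi> j'"
    then have "f j = f j'" using \<pi> by metis
    then show "j = j'"
      using * inj_onD[OF bij_betw_imp_inj_on[OF h[OF f[OF *(1)]]], of j j'] by (auto simp: \<pi>_def)
  qed
  then have "bij_betw \<pi> A A"
    using \<pi> fin by (intro bij_betw_imageI endo_inj_surj) auto
  then show ?thesis using \<pi> by (intro exI[of _ \<pi>] conjI bij_imp_permutes) (auto simp: \<pi>_def)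
qed

text \<open>
  Sorting the elements of \<open>Z\<close> by \<open>h\<close>, expressed through the number of smaller elements. No list
  has to be chosen, so that the position of a point manifestly depends on the set alone.
\<close>

lemma rank_bij_betw:
  fixes h :: "'a \<Rightarrow> real"
  assumes fin: "finite Z" and inj: "inj_on h Z"
  shows "bij_betw (\<lambda>z. card {z'\<in>Z. h z' < h z}) Z {..<card Z}"
proof -
  have less: "card {z'\<in>Z. h z' < h z} < card {z'\<in>Z. h z' < h w}"
    if "z \<in> Z" "w \<in> Z" "h z < h w" for z w
  proof (rule psubset_card_mono)
    have "{z'\<in>Z. h z' < h z} \<subseteq> {z'\<in>Z. h z' < h w}" using that by auto
    moreover have "z \<in> {z'\<in>Z. h z' < h w}" "z \<notin> {z'\<in>Z. h z' < h z}" using that by simp_all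
    ultimately show "{z'\<in>Z. h z' < h z} \<subset> {z'\<in>Z. h z' < h w}" by blast
  qed (use fin in simp)
  have "inj_on (\<lambda>z. card {z'\<in>Z. h z' < h z}) Z"
  proof (rule inj_onI)
    fix z w assume *: "z \<in> Z" "w \<in> Z" "card {z'\<in>Z. h z' < h z} = card {z'\<in>Z. h z' < h w}"
    have "\<not> h z < h w" "\<not> h w < h z" using less[OF *(1,2)] less[OF *(2,1)] *(3) by linarith+
    then have "h z = h w" by simp
    then show "z = w" using inj_onD[OF inj] *(1,2) by blast
  qed
  moreover have "(\<lambda>z. card {z'\<in>Z. h z' < h z}) ` Z \<subseteq> {..<card Z}"
  proof safe
    fix z assume "z \<in> Z"
    then show "card {z' \<in> Z. h z' < h z} < card Z"
      using fin by (intro psubset_card_mono) auto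
  qed
  ultimately show ?thesis
    by (intro bij_betw_imageI card_subset_eq) (auto simp: card_image)
qed

text \<open>
  All that is needed of the position of the blocks in \<open>{..<r}\<close> is the map that sends an index to the
  block containing it. A block is named by \<open>(i, k)\<close>, where \<open>\<rho> i\<close> is its size and \<open>k\<close> its number
  among the blocks of that size. The group \<open>S\<^sub>\<sigma>\<close> consists of the permutations that preserve labels.
\<close>

locale block_labelling =
  fixes r s :: nat and a \<rho> :: "nat \<Rightarrow> nat" and lab :: "nat \<Rightarrow> nat \<times> nat"
  assumes lab_mem: "j < r \<Longrightarrow> lab j \<in> (SIGMA i:{1..s}. {..<a i})"
    and card_lab: "b \<in> (SIGMA i:{1..s}. {..<a i}) \<Longrightarrow> card {j. j < r \<and> lab j = b} = \<rho> (fst b)"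
    and part_pos: "i \<in> {1..s} \<Longrightarrow> \<rho> i > 0"
    and part_inj: "inj_on \<rho> {1..s}"
    and young_eq: "young_subgroup r s a \<rho> =
      {\<pi>. \<pi> permutes {..<r} \<and> (\<forall>j<r. lab (\<pi> j) = lab j)}"
begin

abbreviation labels :: "(nat \<times> nat) set" where
  "labels \<equiv> SIGMA i:{1..s}. {..<a i}"

abbreviation Young :: "(nat \<Rightarrow> nat) set" where
  "Young \<equiv> young_subgroup r s a \<rho>"

sublocale Young: perm_group Young r
proof
  show "\<pi> permutes {..<r}" if "\<pi> \<in> Young" for \<pi> using that by (simp add: young_eq)
  show "id \<in> Young" by (simp add: young_eq permutes_id)
  show "\<pi> \<circ> \<tau> \<in> Young" if "\<pi> \<in> Young" "\<tau> \<in> Young" for \<pi> \<tau>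
    using that by (auto simp: young_eq permutes_compose permutes_less)
  show "inv \<pi> \<in> Young" if "\<pi> \<in> Young" for \<pi>
  proof -
    have \<pi>: "\<pi> permutes {..<r}" and l: "\<And>j. j < r \<Longrightarrow> lab (\<pi> j) = lab j"
      using that by (auto simp: young_eq)
    have "lab (inv \<pi> j) = lab j" if "j < r" for j
      using l[of "inv \<pi> j"] that permutes_less[OF permutes_inv[OF \<pi>], of j]
      by (simp add: permutes_inverses(1)[OF \<pi>])
    then show ?thesis using permutes_inv[OF \<pi>] by (simp add: young_eq)
  qed
qed

sublocale Symmetric: perm_group "symmetric_group r" r
  by (rule perm_group_symmetric)

lemma ex_lab: "b \<in> labels \<Longrightarrow> \<exists>j<r. lab j = b"
proof -
  assume b: "b \<in> labels"
  then have "card {j. j < r \<and> lab j = b} > 0" using card_lab[OF b] part_pos[of "fst b"] by auto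
  then show ?thesis by (auto simp: card_gt_0_iff)
qed

text \<open>
  The entries are listed in normal form: equal entries fill the blocks, and the values on blocks of
  the same size increase with respect to \<open>h\<close>.
\<close>

definition normal :: "('v \<Rightarrow> real) \<Rightarrow> (nat \<Rightarrow> 'v) \<Rightarrow> bool" where
  "normal h x \<longleftrightarrow> (\<forall>j<r. \<forall>j'<r. (lab j = lab j' \<longleftrightarrow> x j = x j') \<and>
     (fst (lab j) = fst (lab j') \<and> snd (lab j) < snd (lab j') \<longrightarrow> h (x j) < h (x j')))"

text \<open>
  The block in which a value has to stand in a normal form, computed from the unordered
  configuration: its multiplicity gives the size of the block, and its rank among the values of this
  multiplicity gives the number of the block. The size itself is recorded in place of its index.
\<close>

definition value_label :: "('v \<Rightarrow> real) \<Rightarrow> (nat \<Rightarrow> 'v) \<Rightarrow> 'v \<Rightarrow> nat \<times> nat" where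
  "value_label h x z = (occurrences r x z, card {z'. occurrences r x z' = occurrences r x z \<and> h z' < h z})"

lemma value_label_permute:
  "\<pi> permutes {..<r} \<Longrightarrow> value_label h (permute r \<pi> x) z = value_label h x z"
  by (simp add: value_label_def occurrences_permute)

lemma occurrences_normal:
  assumes "normal h x" "j < r"
  shows "occurrences r x (x j) = \<rho> (fst (lab j))"
proof -
  have "{j'. j' < r \<and> x j' = x j} = {j'. j' < r \<and> lab j' = lab j}"
    using assms by (auto simp: normal_def)
  then show ?thesis using card_lab[OF lab_mem[OF assms(2)]] by (simp add: occurrences_def)
qed

text \<open>
  The values of multiplicity \<open>\<rho> i\<close> are listed without repetition by representatives \<open>g k\<close> of the
  blocks of size \<open>\<rho> i\<close>.
\<close>

lemma occurrences_eq_normal: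
  assumes x: "normal h x" and i: "i \<in> {1..s}"
    and g: "\<And>k. k < a i \<Longrightarrow> g k < r \<and> lab (g k) = (i, k)"
  shows "{z. occurrences r x z = \<rho> i} = (\<lambda>k. x (g k)) ` {..<a i}"
    and "inj_on (\<lambda>k. x (g k)) {..<a i}"
proof -
  show "inj_on (\<lambda>k. x (g k)) {..<a i}"
    using x g by (intro inj_onI) (metis lessThan_iff normal_def snd_conv)
  show "{z. occurrences r x z = \<rho> i} = (\<lambda>k. x (g k)) ` {..<a i}"
  proof (intro equalityI subsetI)
    fix z assume "z \<in> {z. occurrences r x z = \<rho> i}"
    then have z: "occurrences r x z = \<rho> i" by simp
    then have "z \<in> x ` {..<r}" using part_pos[OF i] by (simp flip: occurrences_pos_iff[of r x])
    then obtain j where j: "j < r" "z = x j" by auto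
    then have "\<rho> (fst (lab j)) = \<rho> i" using z occurrences_normal[OF x] by simp
    then have "fst (lab j) = i"
      using lab_mem[OF j(1)] i inj_onD[OF part_inj] by (auto simp: mem_Sigma_iff split: prod.splits)
    then have "lab j = (i, snd (lab j))" "snd (lab j) < a i"
      using lab_mem[OF j(1)] by (auto split: prod.splits)
    then have "x j = x (g (snd (lab j)))"
      using g[of "snd (lab j)"] x j by (auto simp: normal_def)
    then show "z \<in> (\<lambda>k. x (g k)) ` {..<a i}" using j \<open>snd (lab j) < a i\<close> by auto
  next
    fix z assume "z \<in> (\<lambda>k. x (g k)) ` {..<a i}"
    then show "z \<in> {z. occurrences r x z = \<rho> i}" using g occurrences_normal[OF x] by auto
  qed
qed

lemma ex_section:
  assumes "i \<in> {1..s}"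
  obtains g where "\<And>k. k < a i \<Longrightarrow> g k < r \<and> lab (g k) = (i, k)"
proof -
  have "\<forall>k<a i. \<exists>j. j < r \<and> lab j = (i, k)" using ex_lab assms by auto
  then show ?thesis using that by metis
qed

lemma normal_imp_coincidences:
  assumes "normal h x"
  shows "coincidences_given_by r s a \<rho> x"
  unfolding coincidences_given_by_occurrences
proof
  fix i assume i: "i \<in> {1..s}"
  obtain g where "\<And>k. k < a i \<Longrightarrow> g k < r \<and> lab (g k) = (i, k)" by (rule ex_section[OF i]) auto
  from occurrences_eq_normal[OF assms i this] show "card {z. occurrences r x z = \<rho> i} = a i"
    by (simp add: card_image)
qed

lemma value_label_normal:
  assumes x: "normal h x" and j: "j < r"
  shows "value_label h x (x j) = map_prod \<rho> id (lab j)"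
proof -
  define i k where "i = fst (lab j)" and "k = snd (lab j)"
  have ik: "i \<in> {1..s}" "k < a i" "lab j = (i, k)" using lab_mem[OF j] by (auto simp: i_def k_def)
  obtain g where g: "\<And>k. k < a i \<Longrightarrow> g k < r \<and> lab (g k) = (i, k)"
    by (rule ex_section[OF ik(1)]) auto
  note Z = occurrences_eq_normal[OF x ik(1) g, simplified]
  have less: "h (x (g k')) < h (x j) \<longleftrightarrow> k' < k" if "k' < a i" for k'
  proof -
    have "k' < k \<Longrightarrow> h (x (g k')) < h (x j)" "k < k' \<Longrightarrow> h (x j) < h (x (g k'))"
      "k' = k \<Longrightarrow> x (g k') = x j"
      using x j g[OF that] ik unfolding normal_def by (metis fst_conv snd_conv)+
    then show ?thesis by (metis less_asym less_irrefl linorder_neqE_nat)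
  qed
  have "{z'. occurrences r x z' = \<rho> i \<and> h z' < h (x j)} = (\<lambda>k. x (g k)) ` {..<k}"
  proof -
    have "{z'. occurrences r x z' = \<rho> i \<and> h z' < h (x j)} = {z'\<in>(\<lambda>k. x (g k)) ` {..<a i}. h z' < h (x j)}"
      using Z(1) by blast
    also have "\<dots> = (\<lambda>k. x (g k)) ` {..<k}" using less ik(2) by force
    finally show ?thesis .
  qed
  moreover have "inj_on (\<lambda>k. x (g k)) {..<k}"
    by (rule inj_on_subset[OF Z(2)]) (use ik in auto)
  ultimately show ?thesis
    using occurrences_normal[OF x j] ik(3) by (simp add: value_label_def card_image)
qed

text \<open>
  Uniqueness of the normal form. The label of an index can be read off from the value at that index
  and the unordered configuration, and the latter is not changed by \<open>\<pi>\<close>.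
\<close>

lemma normal_permute_imp_Young:
  assumes "normal h x" "normal h (permute r \<pi> x)" and \<pi>: "\<pi> permutes {..<r}"
  shows "\<pi> \<in> Young"
proof -
  have "lab (\<pi> j) = lab j" if j: "j < r" for j
  proof -
    have "map_prod \<rho> id (lab j) = value_label h x (permute r \<pi> x j)"
      using value_label_normal[OF assms(2) j] by (simp add: value_label_permute[OF \<pi>])
    also have "\<dots> = map_prod \<rho> id (lab (\<pi> j))"
      using value_label_normal[OF assms(1), of "\<pi> j"] j by (simp add: permutes_less[OF \<pi>] permute_apply)
    finally show ?thesis
      using lab_mem[OF j] lab_mem[of "\<pi> j"] j inj_onD[OF part_inj]
      by (auto simp: permutes_less[OF \<pi>] prod_eq_iff)
  qed
  then show ?thesis using \<pi> by (simp add: young_eq)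
qed

lemma permute_Young_normal:
  assumes "normal h x" "\<pi> \<in> Young" "x \<in> {..<r} \<rightarrow>\<^sub>E X"
  shows "permute r \<pi> x = x"
proof
  fix j
  have \<pi>: "\<pi> permutes {..<r}" using assms Young.perms by blast
  have "x (\<pi> j) = x j" if "j < r"
    using assms that by (auto simp: young_eq normal_def permutes_less)
  then show "permute r \<pi> x j = x j" using PiE_arb[OF assms(3)] by (auto simp: permute_def)
qed

text \<open>
  Existence of the normal form. On the values of multiplicity \<open>\<rho> i\<close>, the rank is a bijection to
  \<open>{..<a i}\<close>, because there are \<open>a i\<close> such values. Hence the labels of the
  values occur exactly as often as the labels of the indices, and a permutation matches them.
\<close>

lemma ex_permute_normal:
  assumes c: "coincidences_given_by r s a \<rho> x" and inj: "inj_on h (x ` {..<r})"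
  shows "\<exists>\<pi>. \<pi> permutes {..<r} \<and> normal h (permute r \<pi> x)"
proof -
  define Z where "Z i = {z. occurrences r x z = \<rho> i}" for i
  have Zsub: "Z i \<subseteq> x ` {..<r}" if "i \<in> {1..s}" for i
    using part_pos[OF that] by (auto simp: Z_def simp flip: occurrences_pos_iff)
  have rank: "bij_betw (\<lambda>z. card {z'\<in>Z i. h z' < h z}) (Z i) {..<a i}" if "i \<in> {1..s}" for i
  proof -
    have "finite (Z i)" using Zsub[OF that] finite_subset by blast
    moreover have "card (Z i) = a i" using c that by (simp add: Z_def coincidences_given_by_occurrences)
    ultimately show ?thesis using rank_bij_betw[of "Z i" h] inj_on_subset[OF inj Zsub[OF that]] by simp
  qed
  have vl: "value_label h x z = (\<rho> i, card {z'\<in>Z i. h z' < h z})" if "z \<in> Z i" for i z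
    using that by (simp add: value_label_def Z_def)
  have "\<exists>\<pi>. \<pi> permutes {..<r} \<and> (\<forall>j\<in>{..<r}. value_label h x (x (\<pi> j)) = map_prod \<rho> id (lab j))"
  proof (rule ex_permutation_matching_labels[where I = "map_prod \<rho> id ` labels"])
    show "map_prod \<rho> id (lab j) \<in> map_prod \<rho> id ` labels" if "j \<in> {..<r}" for j
      using that by (intro imageI lab_mem) simp
    fix b' assume "b' \<in> map_prod \<rho> id ` labels"
    then obtain i k where b': "b' = (\<rho> i, k)" and i: "i \<in> {1..s}" and k: "k < a i" by auto
    obtain z where z: "z \<in> Z i" "card {z'\<in>Z i. h z' < h z} = k"
      using k bij_betw_imp_surj_on[OF rank[OF i]] by (metis (no_types, lifting) imageE lessThan_iff)
    have "value_label h x (x j) = (\<rho> i, k) \<longleftrightarrow> x j = z" for j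
    proof
      assume *: "value_label h x (x j) = (\<rho> i, k)"
      then have "x j \<in> Z i" by (simp add: value_label_def Z_def)
      then show "x j = z"
        using * vl[of "x j" i] z inj_onD[OF bij_betw_imp_inj_on[OF rank[OF i]], of "x j" z] by simp
    qed (use vl[OF z(1)] z in simp)
    then have "card {j \<in> {..<r}. value_label h x (x j) = b'} = occurrences r x z"
      by (simp add: b' occurrences_def)
    also have "\<dots> = \<rho> i" using z by (simp add: Z_def)
    also have "\<rho> i = card {j. j < r \<and> lab j = (i, k)}" using card_lab[of "(i, k)"] i k by simp
    also have "{j. j < r \<and> lab j = (i, k)} = {j \<in> {..<r}. map_prod \<rho> id (lab j) = b'}"
      using lab_mem i inj_onD[OF part_inj] by (fastforce simp: b')
    finally show "card {j \<in> {..<r}. map_prod \<rho> id (lab j) = b'} =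
      card {j \<in> {..<r}. value_label h x (x j) = b'}" by simp
  qed simp
  then obtain \<pi> where \<pi>: "\<pi> permutes {..<r}"
    and l: "\<And>j. j < r \<Longrightarrow> value_label h x (x (\<pi> j)) = map_prod \<rho> id (lab j)" by auto
  have xZ: "x (\<pi> j) \<in> Z (fst (lab j)) \<and> card {z'\<in>Z (fst (lab j)). h z' < h (x (\<pi> j))} = snd (lab j)"
    if "j < r" for j
    using l[OF that] by (auto simp: value_label_def Z_def map_prod_def prod_eq_iff split: prod.splits)
  have "normal h (permute r \<pi> x)"
    unfolding normal_def
  proof (intro allI impI conjI iffI)
    fix j j' assume j: "j < r" "j' < r"
    \<comment> \<open>The rank is injective on the values of a given multiplicity.\<close>
    show "permute r \<pi> x j = permute r \<pi> x j'" if "lab j = lab j'"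
    proof -
      have "fst (lab j) \<in> {1..s}" using lab_mem[OF j(1)] by auto
      from inj_onD[OF bij_betw_imp_inj_on[OF rank[OF this]]] xZ[OF j(1)] xZ[OF j(2)] j that
      show ?thesis by (simp add: permute_apply)
    qed
    show "lab j = lab j'" if "permute r \<pi> x j = permute r \<pi> x j'"
      using that l[of j] l[of j'] j lab_mem[OF j(1)] lab_mem[OF j(2)] inj_onD[OF part_inj]
      by (auto simp: permute_apply prod_eq_iff)
    assume *: "fst (lab j) = fst (lab j') \<and> snd (lab j) < snd (lab j')"
    show "h (permute r \<pi> x j) < h (permute r \<pi> x j')"
    proof (rule ccontr)
      assume "\<not> ?thesis"
      then have "h (x (\<pi> j')) \<le> h (x (\<pi> j))" using j by (simp add: permute_apply)
      moreover have "finite (Z (fst (lab j)))"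
        using Zsub[of "fst (lab j)"] lab_mem[OF j(1)] finite_subset[of _ "x ` {..<r}"] by auto
      ultimately have "card {z'\<in>Z (fst (lab j)). h z' < h (x (\<pi> j'))} \<le>
          card {z'\<in>Z (fst (lab j)). h z' < h (x (\<pi> j))}"
        by (intro card_mono) auto
      then show False using * xZ[OF j(1)] xZ[OF j(2)] by simp
    qed
  qed
  then show ?thesis using \<pi> by blast
qed

text \<open>
  A tuple that is constant on the blocks takes as many values as there are blocks exactly if it
  separates the blocks.
\<close>

lemma normal_image_card:
  assumes w: "\<And>j j'. j < r \<Longrightarrow> j' < r \<Longrightarrow> lab j = lab j' \<Longrightarrow> x j = x j'"
  shows "card (x ` {..<r}) = card labels \<longleftrightarrow> (\<forall>j<r. \<forall>j'<r. x j = x j' \<longrightarrow> lab j = lab j')"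
proof -
  obtain g where g: "\<And>b. b \<in> labels \<Longrightarrow> g b < r \<and> lab (g b) = b"
    using ex_lab by metis
  have eq: "x ` {..<r} = (\<lambda>b. x (g b)) ` labels"
  proof (intro equalityI subsetI)
    fix z assume "z \<in> x ` {..<r}"
    then obtain j where j: "j < r" "z = x j" by auto
    moreover have "x j = x (g (lab j))" using g[OF lab_mem[OF j(1)]] w j by metis
    ultimately show "z \<in> (\<lambda>b. x (g b)) ` labels" using lab_mem by blast
  qed (use g in blast)
  have "card (x ` {..<r}) = card labels \<longleftrightarrow> inj_on (\<lambda>b. x (g b)) labels"
    unfolding eq by (rule inj_on_iff_eq_card[symmetric]) auto
  also have "\<dots> \<longleftrightarrow> (\<forall>j<r. \<forall>j'<r. x j = x j' \<longrightarrow> lab j = lab j')"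
  proof
    assume inj: "inj_on (\<lambda>b. x (g b)) labels"
    show "\<forall>j<r. \<forall>j'<r. x j = x j' \<longrightarrow> lab j = lab j'"
    proof (intro allI impI)
      fix j j' assume j: "j < r" "j' < r" "x j = x j'"
      then have "x (g (lab j)) = x (g (lab j'))" using g[OF lab_mem] w by metis
      then show "lab j = lab j'" using inj_onD[OF inj] lab_mem j by metis
    qed
  next
    assume "\<forall>j<r. \<forall>j'<r. x j = x j' \<longrightarrow> lab j = lab j'"
    then show "inj_on (\<lambda>b. x (g b)) labels" using g by (intro inj_onI) metis
  qed
  finally show ?thesis .
qed

text \<open>
  For a tuple of type \<open>\<sigma>\<close>, the strict conditions in the normal form follow from the corresponding weak
  ones, which define a closed set: the type fixes the number of distinct values, so a tuple that is
  constant on the blocks separates them, and \<open>h\<close> has distinct values on distinct entries.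
\<close>

lemma normal_iff_weakly:
  assumes c: "coincidences_given_by r s a \<rho> x" and inj: "inj_on h (x ` {..<r})"
  shows "normal h x \<longleftrightarrow> (\<forall>j<r. \<forall>j'<r. (lab j = lab j' \<longrightarrow> x j = x j') \<and>
     (fst (lab j) = fst (lab j') \<and> snd (lab j) < snd (lab j') \<longrightarrow> h (x j) \<le> h (x j')))"
    (is "_ \<longleftrightarrow> ?weak")
proof
  assume "normal h x" then show ?weak unfolding normal_def by (metis less_imp_le)
next
  assume w: ?weak
  obtain \<pi> where \<pi>: "\<pi> permutes {..<r}" and n: "normal h (permute r \<pi> x)"
    using ex_permute_normal[OF c inj] by blast
  have "card (permute r \<pi> x ` {..<r}) = card labels"
    using n by (subst normal_image_card) (auto simp: normal_def)
  then have "card (x ` {..<r}) = card labels" by (simp add: image_permute[OF \<pi>])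
  then have d: "\<And>j j'. j < r \<Longrightarrow> j' < r \<Longrightarrow> x j = x j' \<Longrightarrow> lab j = lab j'"
    using w by (subst (asm) normal_image_card) blast+
  show "normal h x"
    unfolding normal_def
  proof (intro allI impI conjI iffI)
    fix j j' assume j: "j < r" "j' < r"
    show "x j = x j'" if "lab j = lab j'" using w j that by blast
    show "lab j = lab j'" if "x j = x j'" using d j that by blast
    assume *: "fst (lab j) = fst (lab j') \<and> snd (lab j) < snd (lab j')"
    then have "h (x j) \<le> h (x j')" using w j by blast
    moreover have "x j \<noteq> x j'" using d[OF j] * by auto
    then have "h (x j) \<noteq> h (x j')" using inj_onD[OF inj, of "x j" "x j'"] j by auto
    ultimately show "h (x j) < h (x j')" by simp
  qed
qed

end

text \<open>
  The blocks of size \<open>\<rho> i\<close> fill the interval from \<open>S i\<close> to \<open>S (Suc i)\<close>, so the index of the block that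
  contains \<open>j\<close> is the least \<open>i\<close> with \<open>j < S (Suc i)\<close>, and its number is the quotient of \<open>j - S i\<close> by
  \<open>\<rho> i\<close>.
\<close>

lemma ex_block_labelling:
  assumes "partition_type r s a \<rho>"
  shows "\<exists>lab. block_labelling r s a \<rho> lab"
proof -
  define S where "S i = (\<Sum>l=1..<i. a l * \<rho> l)" for i
  have part: "\<And>i j. i \<in> {1..s} \<Longrightarrow> j \<in> {1..s} \<Longrightarrow> i < j \<Longrightarrow> \<rho> i > \<rho> j"
    and pos: "\<And>i. i \<in> {1..s} \<Longrightarrow> \<rho> i > 0" and r: "r = S (Suc s)"
    using assms by (auto simp: partition_type_def S_def atLeastLessThanSuc_atLeastAtMost)
  have Suc: "S (Suc i) = S i + a i * \<rho> i" if "i \<ge> 1" for i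
    using that by (simp add: S_def)
  have mono: "S i \<le> S i'" if "i \<le> i'" for i i'
    unfolding S_def using that by (intro sum_mono2) auto
  have block: "j \<in> block a \<rho> i k \<longleftrightarrow> S i + k * \<rho> i \<le> j \<and> j < S i + k * \<rho> i + \<rho> i" for i j k
    by (auto simp: block_def S_def Let_def)
  have block_range: "S i \<le> j \<and> j < S (Suc i) \<and> k = (j - S i) div \<rho> i"
    if "i \<in> {1..s}" "k < a i" "j \<in> block a \<rho> i k" for i j k
  proof -
    have "Suc k * \<rho> i \<le> a i * \<rho> i" using that by (intro mult_right_mono) auto
    then have "j < S (Suc i)" using that Suc[of i] unfolding block by auto
    moreover have "(j - S i) div \<rho> i = k"
      using that unfolding block by (intro div_nat_eqI) (auto simp: algebra_simps)
    ultimately show ?thesis using that unfolding block by auto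
  qed
  have ex: "\<exists>b. b \<in> (SIGMA i:{1..s}. {..<a i}) \<and> j \<in> block a \<rho> (fst b) (snd b)" if "j < r" for j
  proof -
    define i where "i = (LEAST i. j < S (Suc i))"
    have i: "j < S (Suc i)" unfolding i_def by (rule LeastI[of _ s]) (use that r in simp)
    have "i \<le> s" unfolding i_def by (rule Least_le) (use that r in simp)
    moreover have "i \<noteq> 0" using i by (cases i) (auto simp: S_def)
    ultimately have is_le: "i \<in> {1..s}" by simp
    have "\<not> j < S (Suc (i - 1))" using \<open>i \<noteq> 0\<close> unfolding i_def by (intro not_less_Least) auto
    then have Si: "S i \<le> j" using \<open>i \<noteq> 0\<close> by simp
    have "j - S i < a i * \<rho> i" using i Suc[of i] is_le Si by auto
    then have "(j - S i) div \<rho> i < a i" using pos[OF is_le] by (simp add: less_mult_imp_div_less)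
    moreover have "j \<in> block a \<rho> i ((j - S i) div \<rho> i)"
      using pos[OF is_le] Si div_mult_mod_eq[of "j - S i" "\<rho> i"] mod_less_divisor[OF pos[OF is_le], of "j - S i"]
      unfolding block by linarith
    ultimately show ?thesis using is_le by (intro exI[of _ "(i, (j - S i) div \<rho> i)"]) simp
  qed
  have uniq: "b = b'" if "b \<in> (SIGMA i:{1..s}. {..<a i})" "j \<in> block a \<rho> (fst b) (snd b)"
    "b' \<in> (SIGMA i:{1..s}. {..<a i})" "j \<in> block a \<rho> (fst b') (snd b')" for b b' j
  proof -
    obtain i k i' k' where b: "b = (i, k)" "b' = (i', k')" by fastforce
    have 1: "S i \<le> j \<and> j < S (Suc i) \<and> k = (j - S i) div \<rho> i"
      by (rule block_range) (use that b in auto)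
    have 2: "S i' \<le> j \<and> j < S (Suc i') \<and> k' = (j - S i') div \<rho> i'"
      by (rule block_range) (use that b in auto)
    have "\<not> Suc i \<le> i'" "\<not> Suc i' \<le> i"
      using 1 2 mono[of "Suc i" i'] mono[of "Suc i'" i] by linarith+
    then have "i = i'" by simp
    then show ?thesis using 1 2 b by simp
  qed
  obtain lab where lab: "\<And>j. j < r \<Longrightarrow>
      lab j \<in> (SIGMA i:{1..s}. {..<a i}) \<and> j \<in> block a \<rho> (fst (lab j)) (snd (lab j))"
    using ex by metis
  have lt: "j < r" if "i \<in> {1..s}" "k < a i" "j \<in> block a \<rho> i k" for i j k
    using block_range[OF that] mono[of "Suc i" "Suc s"] that r by auto
  have blk: "block a \<rho> i k = {j. j < r \<and> lab j = (i, k)}" if "i \<in> {1..s}" "k < a i" for i k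
  proof (intro set_eqI iffI)
    fix j assume j: "j \<in> block a \<rho> i k"
    then have "j < r" using lt that by blast
    then show "j \<in> {j. j < r \<and> lab j = (i, k)}"
      using uniq[of "lab j" j "(i, k)"] lab[of j] that j by auto
  next
    fix j assume "j \<in> {j. j < r \<and> lab j = (i, k)}"
    then show "j \<in> block a \<rho> i k" using lab[of j] by auto
  qed
  show ?thesis
  proof (intro exI[of _ lab] block_labelling.intro)
    show "lab j \<in> (SIGMA i:{1..s}. {..<a i})" if "j < r" for j using lab that by blast
    show "card {j. j < r \<and> lab j = b} = \<rho> (fst b)" if b: "b \<in> (SIGMA i:{1..s}. {..<a i})" for b
    proof -
      have "{j. j < r \<and> lab j = b} = block a \<rho> (fst b) (snd b)" using blk b by auto
      then show ?thesis by (simp add: block_def Let_def)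
    qed
    show "\<rho> i > 0" if "i \<in> {1..s}" for i using pos that .
    show "inj_on \<rho> {1..s}" using part by (intro inj_onI) (metis less_irrefl linorder_neqE_nat)
    show "young_subgroup r s a \<rho> = {\<pi>. \<pi> permutes {..<r} \<and> (\<forall>j<r. lab (\<pi> j) = lab j)}"
    proof (intro set_eqI iffI)
      fix \<pi> assume \<pi>: "\<pi> \<in> young_subgroup r s a \<rho>"
      have "lab (\<pi> j) = lab j" if "j < r" for j
      proof -
        obtain i k where ik: "lab j = (i, k)" by fastforce
        then have m: "i \<in> {1..s}" "k < a i" using lab[OF that] by auto
        have "j \<in> block a \<rho> i k" using blk[OF m] that ik by simp
        moreover have "\<pi> ` block a \<rho> i k = block a \<rho> i k"
          using \<pi> m by (simp add: young_subgroup_def)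
        ultimately have "\<pi> j \<in> block a \<rho> i k" by blast
        then show ?thesis using blk[OF m] ik by simp
      qed
      then show "\<pi> \<in> {\<pi>. \<pi> permutes {..<r} \<and> (\<forall>j<r. lab (\<pi> j) = lab j)}"
        using \<pi> by (simp add: young_subgroup_def)
    next
      fix \<pi> assume "\<pi> \<in> {\<pi>. \<pi> permutes {..<r} \<and> (\<forall>j<r. lab (\<pi> j) = lab j)}"
      then have \<pi>: "\<pi> permutes {..<r}" and l: "\<And>j. j < r \<Longrightarrow> lab (\<pi> j) = lab j" by auto
      have "\<pi> ` block a \<rho> i k = block a \<rho> i k" if "i \<in> {1..s}" "k < a i" for i k
      proof (rule endo_inj_surj)
        show "\<pi> ` block a \<rho> i k \<subseteq> block a \<rho> i k"
          by (simp add: blk[OF that] image_subset_iff l permutes_less[OF \<pi>])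
        show "inj_on \<pi> (block a \<rho> i k)" by (rule permutes_inj_on[OF \<pi>])
        show "finite (block a \<rho> i k)" by (simp add: blk[OF that])
      qed
      then show "\<pi> \<in> young_subgroup r s a \<rho>" using \<pi> by (simp add: young_subgroup_def)
    qed
  qed
qed

section \<open>Continuity on symmetric products\<close>

lemma continuous_map_permute:
  "\<pi> permutes {..<r} \<Longrightarrow>
   continuous_map (product_topology (\<lambda>_. Y) {..<r}) (product_topology (\<lambda>_. Y) {..<r}) (permute r \<pi>)"
  by (auto simp: continuous_map_componentwise permute_def permutes_less
      intro!: continuous_map_product_projection)

definition firsts :: "nat \<Rightarrow> (nat \<Rightarrow> 'a \<times> 'b) \<Rightarrow> nat \<Rightarrow> 'a" where
  "firsts r x = (\<lambda>j\<in>{..<r}. fst (x j))"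

definition seconds :: "nat \<Rightarrow> (nat \<Rightarrow> 'a \<times> 'b) \<Rightarrow> nat \<Rightarrow> 'b" where
  "seconds r x = (\<lambda>j\<in>{..<r}. snd (x j))"

definition pair_up :: "nat \<Rightarrow> (nat \<Rightarrow> 'a) \<Rightarrow> (nat \<Rightarrow> 'b) \<Rightarrow> nat \<Rightarrow> 'a \<times> 'b" where
  "pair_up r x y = (\<lambda>j\<in>{..<r}. (x j, y j))"

lemma
  assumes "\<pi> permutes {..<r}"
  shows firsts_permute: "firsts r (permute r \<pi> x) = permute r \<pi> (firsts r x)"
    and seconds_permute: "seconds r (permute r \<pi> x) = permute r \<pi> (seconds r x)"
    and pair_up_permute: "pair_up r (permute r \<pi> l) (permute r \<pi> m) = permute r \<pi> (pair_up r l m)"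
  using permutes_less[OF assms] by (auto simp: firsts_def seconds_def pair_up_def permute_def fun_eq_iff)

lemma
  shows firsts_pair_up: "l \<in> {..<r} \<rightarrow>\<^sub>E X \<Longrightarrow> firsts r (pair_up r l m) = l"
    and seconds_pair_up: "m \<in> {..<r} \<rightarrow>\<^sub>E X \<Longrightarrow> seconds r (pair_up r l m) = m"
    and pair_up_firsts_seconds: "x \<in> {..<r} \<rightarrow>\<^sub>E Z \<Longrightarrow> pair_up r (firsts r x) (seconds r x) = x"
  by (auto simp: firsts_def seconds_def pair_up_def PiE_def extensional_def fun_eq_iff)

lemma
  shows firsts_PiE: "x \<in> {..<r} \<rightarrow>\<^sub>E X \<times> Y \<Longrightarrow> firsts r x \<in> {..<r} \<rightarrow>\<^sub>E X"
    and seconds_PiE: "x \<in> {..<r} \<rightarrow>\<^sub>E X \<times> Y \<Longrightarrow> seconds r x \<in> {..<r} \<rightarrow>\<^sub>E Y"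
    and pair_up_PiE: "l \<in> {..<r} \<rightarrow>\<^sub>E X \<Longrightarrow> m \<in> {..<r} \<rightarrow>\<^sub>E Y \<Longrightarrow> pair_up r l m \<in> {..<r} \<rightarrow>\<^sub>E X \<times> Y"
  by (auto simp: firsts_def seconds_def pair_up_def PiE_iff mem_Times_iff)

lemma
  shows continuous_map_firsts: "continuous_map (product_topology (\<lambda>_. top_of_set (X \<times> Y)) {..<r})
      (product_topology (\<lambda>_. top_of_set X) {..<r}) (firsts r)"
    and continuous_map_seconds: "continuous_map (product_topology (\<lambda>_. top_of_set (X \<times> Y)) {..<r})
      (product_topology (\<lambda>_. top_of_set Y) {..<r}) (seconds r)"
proof -
  have pr: "continuous_map (product_topology (\<lambda>_. top_of_set (X \<times> Y)) {..<r}) (top_of_set (X \<times> Y)) (\<lambda>x. x j)"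
    if "j < r" for j
    using continuous_map_product_projection[of j "{..<r}" "\<lambda>_. top_of_set (X \<times> Y)"] that by simp
  have "continuous_map (top_of_set (X \<times> Y)) (top_of_set X) fst"
    "continuous_map (top_of_set (X \<times> Y)) (top_of_set Y) snd"
    by (auto intro!: continuous_intros)
  note * = continuous_map_compose[OF pr this(1), unfolded o_def]
    continuous_map_compose[OF pr this(2), unfolded o_def]
  show "continuous_map (product_topology (\<lambda>_. top_of_set (X \<times> Y)) {..<r})
      (product_topology (\<lambda>_. top_of_set X) {..<r}) (firsts r)"
    "continuous_map (product_topology (\<lambda>_. top_of_set (X \<times> Y)) {..<r})
      (product_topology (\<lambda>_. top_of_set Y) {..<r}) (seconds r)"
    using * by (auto simp: continuous_map_componentwise firsts_def seconds_def)
qed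

lemma continuous_map_pair_up:
  assumes f: "continuous_map Z (product_topology (\<lambda>_. top_of_set X) {..<r}) f"
    and g: "continuous_map Z (product_topology (\<lambda>_. top_of_set Y) {..<r}) g"
  shows "continuous_map Z (product_topology (\<lambda>_. top_of_set (X \<times> Y)) {..<r}) (\<lambda>z. pair_up r (f z) (g z))"
proof -
  have "continuous_map Z (top_of_set (X \<times> Y)) (\<lambda>z. (f z j, g z j))" if "j < r" for j
  proof -
    have "continuous_map Z (prod_topology (top_of_set X) (top_of_set Y)) (\<lambda>z. (f z j, g z j))"
      using f g that by (intro continuous_map_pairedI) (auto simp: continuous_map_componentwise)
    then show ?thesis by simp
  qed
  then show ?thesis by (auto simp: continuous_map_componentwise pair_up_def)
qed

text \<open>
  In contrast to quotient maps in general, open ones are preserved by restriction to saturated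
  subspaces and by products.
\<close>

definition open_quotient :: "'a topology \<Rightarrow> 'b topology \<Rightarrow> ('a \<Rightarrow> 'b) \<Rightarrow> bool" where
  "open_quotient X Y q \<longleftrightarrow> continuous_map X Y q \<and> open_map X Y q \<and> q ` topspace X = topspace Y"

lemma open_quotient_imp_quotient_map: "open_quotient X Y q \<Longrightarrow> quotient_map X Y q"
  by (simp add: open_quotient_def continuous_open_imp_quotient_map)

lemma continuous_map_open_quotient_compose:
  "open_quotient X Y q \<Longrightarrow> continuous_map Z X f \<Longrightarrow> continuous_map Z Y (\<lambda>z. q (f z))"
  using continuous_map_compose[of Z X f Y q] by (simp add: open_quotient_def o_def)

lemma open_quotient_restriction:
  assumes "open_quotient X Y q"
  shows "open_quotient (subtopology X {x \<in> topspace X. q x \<in> U}) (subtopology Y U) q"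
  using assms unfolding open_quotient_def
  by (auto simp: continuous_map_in_subtopology continuous_map_from_subtopology
      intro!: open_map_restriction)

lemma open_quotient_map_prod:
  assumes q: "open_quotient X Y q" and q': "open_quotient X' Y' q'"
  shows "open_quotient (prod_topology X X') (prod_topology Y Y') (map_prod q q')"
proof -
  have "continuous_map (prod_topology X X') (prod_topology Y Y') (map_prod q q')"
    using q q' unfolding open_quotient_def map_prod_def
    by (auto simp: continuous_map_prod_top)
  moreover have "open_map (prod_topology X X') (prod_topology Y Y') (map_prod q q')"
    unfolding open_map_def
  proof (intro allI impI)
    fix W assume W: "openin (prod_topology X X') W"
    show "openin (prod_topology Y Y') (map_prod q q' ` W)"
      unfolding openin_prod_topology_alt
    proof (intro allI impI)
      fix y y' assume "(y, y') \<in> map_prod q q' ` W"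
      then obtain x x' where x: "(x, x') \<in> W" "y = q x" "y' = q' x'" by auto
      then obtain U V where UV: "openin X U" "openin X' V" "x \<in> U" "x' \<in> V" "U \<times> V \<subseteq> W"
        using W unfolding openin_prod_topology_alt by metis
      have "openin Y (q ` U)" "openin Y' (q' ` V)"
        using UV q q' by (auto simp: open_quotient_def open_map_def)
      moreover have "q ` U \<times> q' ` V \<subseteq> map_prod q q' ` W" using UV by force
      ultimately show "\<exists>U V. openin Y U \<and> openin Y' V \<and> y \<in> U \<and> y' \<in> V \<and> U \<times> V \<subseteq> map_prod q q' ` W"
        using UV x by blast
    qed
  qed
  moreover have "map_prod q q' ` topspace (prod_topology X X') = topspace (prod_topology Y Y')"
    using q q' by (simp add: open_quotient_def map_prod_surj_on)
  ultimately show ?thesis by (simp add: open_quotient_def)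
qed

text \<open>
  The saturation of a set \<open>V\<close> is the union of its translates, and these are open if \<open>V\<close> is.
\<close>

lemma (in perm_group) open_quotient_orbit:
  "open_quotient (product_topology (\<lambda>_. Y) {..<r})
     (quotient_topology (product_topology (\<lambda>_. Y) {..<r}) (orbit G r)) (orbit G r)"
proof -
  let ?P = "product_topology (\<lambda>_. Y) {..<r}"
  have qm: "quotient_map ?P (quotient_topology ?P (orbit G r)) (orbit G r)"
    by (rule quotient_map_quotient_topology)
  have "open_map ?P (quotient_topology ?P (orbit G r)) (orbit G r)"
    unfolding open_map_def
  proof (intro allI impI)
    fix V assume V: "openin ?P V"
    then have Vsub: "V \<subseteq> topspace ?P" by (rule openin_subset)
    have "{x \<in> topspace ?P. orbit G r x \<in> orbit G r ` V} =
        (\<Union>\<pi>\<in>G. {x \<in> topspace ?P. permute r \<pi> x \<in> V})"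
    proof (intro equalityI subsetI)
      fix x assume "x \<in> {x \<in> topspace ?P. orbit G r x \<in> orbit G r ` V}"
      then obtain v where x: "x \<in> topspace ?P" and v: "v \<in> V" "orbit G r v = orbit G r x" by auto
      have "v \<in> {..<r} \<rightarrow>\<^sub>E topspace Y" using v Vsub by auto
      from orbit_eq_iff[OF this, of x] v x
      show "x \<in> (\<Union>\<pi>\<in>G. {x \<in> topspace ?P. permute r \<pi> x \<in> V})" by auto
    next
      fix x assume "x \<in> (\<Union>\<pi>\<in>G. {x \<in> topspace ?P. permute r \<pi> x \<in> V})"
      then obtain \<pi> where "\<pi> \<in> G" "x \<in> topspace ?P" "permute r \<pi> x \<in> V" by blast
      then show "x \<in> {x \<in> topspace ?P. orbit G r x \<in> orbit G r ` V}"
        using orbit_permute_eq[of \<pi> x] by (metis (mono_tags, lifting) imageI mem_Collect_eq)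
    qed
    moreover have "openin ?P {x \<in> topspace ?P. permute r \<pi> x \<in> V}" if "\<pi> \<in> G" for \<pi>
      by (rule openin_continuous_map_preimage[OF continuous_map_permute[OF perms[OF that]] V])
    ultimately have "openin ?P {x \<in> topspace ?P. orbit G r x \<in> orbit G r ` V}" by auto
    then show "openin (quotient_topology ?P (orbit G r)) (orbit G r ` V)"
      using Vsub unfolding openin_quotient_topology by blast
  qed
  then show ?thesis
    unfolding open_quotient_def
    using quotient_imp_continuous_map[OF qm] quotient_imp_surjective_map[OF qm] by blast
qed

text \<open>
  A map out of a quotient may be given by different formulas \<open>f i\<close> upstairs, on finitely many
  closed sets that cut across the fibres of \<open>q\<close>.
\<close>

lemma continuous_map_from_quotient_piecewise:
  assumes q: "quotient_map X Q q" and fin: "finite J"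
    and closed: "\<And>i. i \<in> J \<Longrightarrow> closedin X (C i)"
    and cover: "\<And>x. x \<in> topspace X \<Longrightarrow> \<exists>i\<in>J. x \<in> C i"
    and cont: "\<And>i. i \<in> J \<Longrightarrow> continuous_map (subtopology X (C i)) Z (f i)"
    and eq: "\<And>i x. i \<in> J \<Longrightarrow> x \<in> topspace X \<Longrightarrow> x \<in> C i \<Longrightarrow> g (q x) = f i x"
  shows "continuous_map Q Z g"
proof (rule continuous_compose_quotient_map[OF q])
  show "continuous_map X Z (g \<circ> q)"
  proof (rule pasting_lemma_closed[OF fin closed cont])
    fix x assume "x \<in> topspace X"
    then show "\<exists>j. j \<in> J \<and> x \<in> C j \<and> (g \<circ> q) x = f j x" using cover[of x] eq by fastforce
  qed (auto simp flip: eq)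
qed

lemma continuous_orbit:
  "continuous_map X (product_topology (\<lambda>_. Y) {..<r}) f \<Longrightarrow>
   continuous_map X (quotient_topology (product_topology (\<lambda>_. Y) {..<r}) (orbit G r)) (\<lambda>x. orbit G r (f x))"
  using continuous_map_compose[OF _ quotient_imp_continuous_map[OF quotient_map_quotient_topology]]
  by (fastforce simp: o_def)

lemma closedin_Collect_ball:
  assumes "\<And>j. j \<in> J \<Longrightarrow> closedin X {x \<in> topspace X. P j x}"
  shows "closedin X {x \<in> topspace X. \<forall>j\<in>J. P j x}"
proof (cases "J = {}")
  case False
  then have "{x \<in> topspace X. \<forall>j\<in>J. P j x} = (\<Inter>j\<in>J. {x \<in> topspace X. P j x})" by auto
  then show ?thesis using assms False by auto
qed auto

lemma closedin_Collect_imp: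
  "(P \<Longrightarrow> closedin X {x \<in> topspace X. Q x}) \<Longrightarrow> closedin X {x \<in> topspace X. P \<longrightarrow> Q x}"
  by (cases P) simp_all

lemma closedin_Collect_conj:
  assumes "closedin X {x \<in> topspace X. P x}" "closedin X {x \<in> topspace X. Q x}"
  shows "closedin X {x \<in> topspace X. P x \<and> Q x}"
proof -
  have "{x \<in> topspace X. P x \<and> Q x} = {x \<in> topspace X. P x} \<inter> {x \<in> topspace X. Q x}" by blast
  then show ?thesis using closedin_Int[OF assms] by (simp only:)
qed

section \<open>Cutting the circle at a point\<close>

text \<open>
  The slope of the line through \<open>1\<close> and \<open>w = z / p\<close>, up to sign and with \<open>0\<close> as its value at \<open>z = p\<close>:
  for \<open>w = exp (\<i> \<theta>)\<close> it is \<open>cot (\<theta> / 2)\<close>. This is a stereographic coordinate on the circle without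
  \<open>p\<close>.
\<close>

definition slope :: "complex \<Rightarrow> complex \<Rightarrow> real" where
  "slope p z = Im (z * cnj p) / (1 - Re (z * cnj p))"

lemma Re_mult_cnj_less_1:
  assumes "z \<in> unit_circle" "p \<in> unit_circle" "z \<noteq> p"
  shows "Re (z * cnj p) < 1"
proof -
  let ?w = "z * cnj p"
  have w: "norm ?w = 1" using assms by (simp add: norm_mult)
  have "Re ?w \<noteq> 1"
  proof
    assume 1: "Re ?w = 1"
    then have "Im ?w = 0" using w cmod_power2[of ?w] by simp
    then have "?w = 1" using 1 by (simp add: complex_eq_iff)
    then have "z * (cnj p * p) = p" by (simp add: mult.assoc[symmetric])
    moreover have "cnj p * p = 1"
      using assms(2) complex_norm_square[of p] by (simp add: mult.commute)
    ultimately show False using assms(3) by simp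
  qed
  moreover have "Re ?w \<le> 1" using complex_Re_le_cmod[of ?w] w by simp
  ultimately show ?thesis by simp
qed

text \<open>
  The line with slope \<open>c\<close> meets the circle in \<open>1\<close> and one further point, which has the real part
  \<open>(c\<^sup>2 - 1) / (c\<^sup>2 + 1)\<close>.
\<close>

lemma slope_inj: 
  assumes p: "p \<in> unit_circle"
  shows "inj_on (slope p) (unit_circle - {p})"
proof (rule inj_onI)
  fix z z' assume z: "z \<in> unit_circle - {p}" "z' \<in> unit_circle - {p}" and eq: "slope p z = slope p z'"
  have Re: "Re (u * cnj p) = ((slope p u)\<^sup>2 - 1) / ((slope p u)\<^sup>2 + 1)"
    and Im: "Im (u * cnj p) = slope p u * (1 - Re (u * cnj p))" if "u \<in> unit_circle - {p}" for u
  proof -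
    define R I c where "R = Re (u * cnj p)" and "I = Im (u * cnj p)" and "c = slope p u"
    have R: "R < 1" using Re_mult_cnj_less_1[OF _ p] that unfolding R_def by blast
    have "norm (u * cnj p) = 1" using that p by (simp add: norm_mult)
    then have n: "R\<^sup>2 + I\<^sup>2 = 1" unfolding R_def I_def by (metis cmod_power2 one_power2)
    have "c = I / (1 - R)" unfolding c_def slope_def R_def I_def ..
    then have I: "I = c * (1 - R)" using R by simp
    \<comment> \<open>Insert \<open>I = c (1 - R)\<close> into \<open>R\<^sup>2 + I\<^sup>2 = 1\<close> and cancel the factor \<open>1 - R\<close>.\<close>
    have "(1 - R) * (c\<^sup>2 * (1 - R)) = (1 - R) * (1 + R)"
      using n unfolding I by (simp add: power2_eq_square algebra_simps)
    then have "c\<^sup>2 * (1 - R) = 1 + R" using R by simp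
    then have "R * (c\<^sup>2 + 1) = c\<^sup>2 - 1" by (simp add: algebra_simps)
    moreover have "c\<^sup>2 + 1 \<noteq> 0" by (smt (verit) zero_le_power2)
    ultimately have "R = (c\<^sup>2 - 1) / (c\<^sup>2 + 1)" by (simp add: eq_divide_eq)
    then show "Re (u * cnj p) = ((slope p u)\<^sup>2 - 1) / ((slope p u)\<^sup>2 + 1)"
      by (simp add: R_def c_def)
    show "Im (u * cnj p) = slope p u * (1 - Re (u * cnj p))"
      using I by (simp add: R_def c_def I_def)
  qed
  have "z * cnj p = z' * cnj p"
    using Re[OF z(1)] Re[OF z(2)] Im[OF z(1)] Im[OF z(2)] eq by (simp add: complex_eq_iff)
  moreover have "cnj p \<noteq> 0" using p by auto
  ultimately show "z = z'" by simp
qed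

lemma continuous_on_slope:
  assumes "p \<in> unit_circle"
  shows "continuous_on (unit_circle - {p}) (slope p)"
  unfolding slope_def
  by (intro continuous_intros) (use Re_mult_cnj_less_1[OF _ assms] in fastforce)

text \<open>
  The comparison of slopes is a polynomial inequality, since both denominators are positive.
\<close>

lemma slope_less_iff:
  assumes "p \<in> unit_circle" "z \<in> unit_circle" "z' \<in> unit_circle" "z \<noteq> p" "z' \<noteq> p"
  shows "slope p z < slope p z' \<longleftrightarrow>
    Im (z * cnj p) * (1 - Re (z' * cnj p)) < Im (z' * cnj p) * (1 - Re (z * cnj p))"
proof -
  have "0 < 1 - Re (z * cnj p)" "0 < 1 - Re (z' * cnj p)"
    using Re_mult_cnj_less_1 assms by force+
  then show ?thesis unfolding slope_def by (simp add: pos_divide_less_eq pos_less_divide_eq)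
qed

section \<open>The trivialisation over the configurations that avoid a point\<close>

context block_labelling
begin

abbreviation S_r :: "(nat \<Rightarrow> nat) set" where
  "S_r \<equiv> symmetric_group r"

abbreviation circle_power :: "(nat \<Rightarrow> complex) topology" where
  "circle_power \<equiv> product_topology (\<lambda>_. top_of_set unit_circle) {..<r}"

abbreviation torus_power :: "(nat \<Rightarrow> complex \<times> complex) topology" where
  "torus_power \<equiv> product_topology (\<lambda>_. top_of_set (unit_circle \<times> unit_circle)) {..<r}"

text \<open>
  The sets \<open>avoiding p\<close>, \<open>lifts p\<close> and \<open>unimodular\<close> are the full preimages, in the powers of the
  circle and of the torus, of the chart, of the part of the total space over it and of the fibre.
\<close>

definition avoiding :: "complex \<Rightarrow> (nat \<Rightarrow> complex) set" where
  "avoiding p = {x \<in> {..<r} \<rightarrow>\<^sub>E unit_circle.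
     (\<Prod>j<r. x j) = 1 \<and> coincidences_given_by r s a \<rho> x \<and> p \<notin> x ` {..<r}}"

definition chart :: "complex \<Rightarrow> (nat \<Rightarrow> complex) set set" where
  "chart p = orbit S_r r ` avoiding p"

definition lifts :: "complex \<Rightarrow> (nat \<Rightarrow> complex \<times> complex) set" where
  "lifts p = {x \<in> {..<r} \<rightarrow>\<^sub>E unit_circle \<times> unit_circle.
     firsts r x \<in> avoiding p \<and> (\<Prod>j<r. seconds r x j) = 1}"

definition unimodular :: "(nat \<Rightarrow> complex) set" where
  "unimodular = {y \<in> {..<r} \<rightarrow>\<^sub>E unit_circle. (\<Prod>j<r. y j) = 1}"

lemma coincidences_permute:
  "\<pi> permutes {..<r} \<Longrightarrow> coincidences_given_by r s a \<rho> (permute r \<pi> x) \<longleftrightarrow> coincidences_given_by r s a \<rho> x"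
  by (simp add: coincidences_given_by_occurrences occurrences_permute)

lemma avoiding_permute:
  assumes "\<pi> permutes {..<r}" "x \<in> avoiding p"
  shows "permute r \<pi> x \<in> avoiding p"
  using assms prod_permute[OF assms(1), of "\<lambda>z. z" x]
  by (simp add: avoiding_def permute_PiE coincidences_permute image_permute)

lemma unimodular_permute:
  assumes "\<pi> permutes {..<r}" "x \<in> unimodular"
  shows "permute r \<pi> x \<in> unimodular"
  using assms prod_permute[OF assms(1), of "\<lambda>z. z" x]
  by (simp add: unimodular_def permute_PiE)

lemma lifts_permute:
  assumes "\<pi> permutes {..<r}" "x \<in> lifts p"
  shows "permute r \<pi> x \<in> lifts p"
  using assms prod_permute[OF assms(1), of "\<lambda>z. z" "seconds r x"]
  by (simp add: lifts_def permute_PiE firsts_permute seconds_permute avoiding_permute)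

lemma orbit_mem_iff:
  assumes G: "perm_group G r" and A: "\<And>\<pi> x. \<pi> \<in> G \<Longrightarrow> x \<in> A \<Longrightarrow> permute r \<pi> x \<in> A"
    and x: "x \<in> {..<r} \<rightarrow>\<^sub>E X"
  shows "orbit G r x \<in> orbit G r ` A \<longleftrightarrow> x \<in> A"
proof
  assume "orbit G r x \<in> orbit G r ` A"
  then obtain y where "y \<in> A" "orbit G r x = orbit G r y" by blast
  then show "x \<in> A" using perm_group.orbit_eq_iff[OF G x, of y] A by blast
qed blast

lemma points_circle: "points (SSym_circle r s a \<rho>) =
    orbit S_r r ` {x \<in> {..<r} \<rightarrow>\<^sub>E unit_circle. (\<Prod>j<r. x j) = 1 \<and> coincidences_given_by r s a \<rho> x}"
  by (simp add: SSym_circle_def)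

lemma orbit_mem_points_circle:
  assumes "x \<in> {..<r} \<rightarrow>\<^sub>E unit_circle"
  shows "orbit S_r r x \<in> points (SSym_circle r s a \<rho>) \<longleftrightarrow>
    (\<Prod>j<r. x j) = 1 \<and> coincidences_given_by r s a \<rho> x"
proof -
  have "(\<Prod>j<r. permute r \<pi> y j) = (\<Prod>j<r. y j)" if "\<pi> permutes {..<r}" for \<pi> and y :: "nat \<Rightarrow> complex"
    using prod_permute[OF that, of "\<lambda>z. z" y] .
  then show ?thesis
    unfolding points_circle using assms
    by (subst orbit_mem_iff[OF perm_group_symmetric _ assms])
      (simp_all add: permute_PiE coincidences_permute)
qed

lemma orbit_mem_chart:
  "x \<in> {..<r} \<rightarrow>\<^sub>E unit_circle \<Longrightarrow> orbit S_r r x \<in> chart p \<longleftrightarrow> x \<in> avoiding p"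
  unfolding chart_def by (rule orbit_mem_iff[OF perm_group_symmetric]) (auto simp: avoiding_permute)

lemma chart_subset: "chart p \<subseteq> points (SSym_circle r s a \<rho>)"
  by (auto simp: chart_def points_circle avoiding_def)

lemma points_fibre: "points (SSym_fibre r s a \<rho>) = orbit Young r ` unimodular"
  by (simp add: SSym_fibre_def unimodular_def)

lemma orbit_mem_points_fibre:
  "y \<in> {..<r} \<rightarrow>\<^sub>E unit_circle \<Longrightarrow> orbit Young r y \<in> points (SSym_fibre r s a \<rho>) \<longleftrightarrow> y \<in> unimodular"
  unfolding points_fibre
  by (rule orbit_mem_iff[OF Young.perm_group_axioms]) (auto simp: unimodular_permute Young.perms)

lemma forget_orbit: "forget_snd r (orbit S_r r x) = orbit S_r r (firsts r x)"
  by (simp add: forget_snd_orbit firsts_def)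

lemma points_torus: "points (SSym_torus r s a \<rho>) =
    orbit S_r r ` {x \<in> {..<r} \<rightarrow>\<^sub>E unit_circle \<times> unit_circle. (\<Prod>j<r. firsts r x j) = 1 \<and>
      (\<Prod>j<r. seconds r x j) = 1 \<and> orbit S_r r (firsts r x) \<in> points (SSym_circle r s a \<rho>)}"
  by (simp add: SSym_torus_def firsts_def seconds_def)

lemma forget_mem_points:
  "e \<in> points (SSym_torus r s a \<rho>) \<Longrightarrow> forget_snd r e \<in> points (SSym_circle r s a \<rho>)"
  unfolding points_torus by (elim imageE) (simp add: forget_orbit)

lemma points_over_chart:
  "{e \<in> points (SSym_torus r s a \<rho>). forget_snd r e \<in> chart p} = orbit S_r r ` lifts p"
proof (intro equalityI subsetI)
  fix e assume "e \<in> {e \<in> points (SSym_torus r s a \<rho>). forget_snd r e \<in> chart p}"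
  then obtain x where x: "x \<in> {..<r} \<rightarrow>\<^sub>E unit_circle \<times> unit_circle" "e = orbit S_r r x"
    "(\<Prod>j<r. seconds r x j) = 1" "orbit S_r r (firsts r x) \<in> chart p"
    unfolding points_torus by (auto simp only: forget_orbit mem_Collect_eq elim!: imageE)
  then show "e \<in> orbit S_r r ` lifts p"
    using orbit_mem_chart[OF firsts_PiE[OF x(1)]] by (simp add: lifts_def)
next
  fix e assume "e \<in> orbit S_r r ` lifts p"
  then obtain x where x: "x \<in> lifts p" "e = orbit S_r r x" by auto
  then have "orbit S_r r (firsts r x) \<in> chart p" by (simp add: chart_def lifts_def)
  moreover have "(\<Prod>j<r. firsts r x j) = 1" using x by (simp add: lifts_def avoiding_def)
  ultimately show "e \<in> {e \<in> points (SSym_torus r s a \<rho>). forget_snd r e \<in> chart p}"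
    using x chart_subset[of p] unfolding points_torus by (simp add: forget_orbit lifts_def subset_iff)
qed

lemma orbit_mem_over_chart:
  "x \<in> {..<r} \<rightarrow>\<^sub>E unit_circle \<times> unit_circle \<Longrightarrow> orbit S_r r x \<in> orbit S_r r ` lifts p \<longleftrightarrow> x \<in> lifts p"
  by (rule orbit_mem_iff[OF perm_group_symmetric]) (auto simp: lifts_permute)

text \<open>
  All representatives whose first components are in normal form contribute; their second components
  form one orbit of \<open>S\<^sub>\<sigma>\<close>. Taking the image instead of choosing a representative makes the map well
  defined from the outset.
\<close>

definition fibre_coordinate :: "complex \<Rightarrow> (nat \<Rightarrow> complex \<times> complex) set \<Rightarrow> (nat \<Rightarrow> complex) set" where
  "fibre_coordinate p e = seconds r ` {x \<in> e. normal (slope p) (firsts r x)}"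

definition trivialisation ::
    "complex \<Rightarrow> (nat \<Rightarrow> complex \<times> complex) set \<Rightarrow> (nat \<Rightarrow> complex) set \<times> (nat \<Rightarrow> complex) set" where
  "trivialisation p e = (forget_snd r e, fibre_coordinate p e)"

text \<open>
  The inverse of the trivialisation. Each orbit in the chart contains just one normal tuple \<open>l\<close>, and
  all \<open>m\<close> in the fibre coordinate lead to the same configuration of pairs, so the union does not
  enlarge the orbit.
\<close>

definition assemble ::
    "complex \<Rightarrow> (nat \<Rightarrow> complex) set \<times> (nat \<Rightarrow> complex) set \<Rightarrow> (nat \<Rightarrow> complex \<times> complex) set" where
  "assemble p cd =
     (\<Union>l\<in>{l \<in> fst cd. normal (slope p) l}. \<Union>m\<in>snd cd. orbit S_r r (pair_up r l m))"

lemma slope_inj_avoiding: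
  "p \<in> unit_circle \<Longrightarrow> x \<in> avoiding p \<Longrightarrow> inj_on (slope p) (x ` {..<r})"
  by (rule inj_on_subset[OF slope_inj]) (auto simp: avoiding_def PiE_iff)

lemma ex_permute_normal_avoiding:
  "p \<in> unit_circle \<Longrightarrow> x \<in> avoiding p \<Longrightarrow> \<exists>\<pi>\<in>S_r. normal (slope p) (permute r \<pi> x)"
  using ex_permute_normal[OF _ slope_inj_avoiding, of x p] by (auto simp: avoiding_def)

lemma fibre_coordinate_orbit:
  assumes x: "x \<in> {..<r} \<rightarrow>\<^sub>E unit_circle \<times> unit_circle" and \<pi>: "\<pi> \<in> S_r"
    and n: "normal (slope p) (permute r \<pi> (firsts r x))"
  shows "fibre_coordinate p (orbit S_r r x) = orbit Young r (permute r \<pi> (seconds r x))"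
proof -
  define x' where "x' = permute r \<pi> x"
  have x': "firsts r x' \<in> {..<r} \<rightarrow>\<^sub>E unit_circle"
    using firsts_PiE[OF permute_PiE[OF _ x]] \<pi> by (simp add: x'_def)
  have n': "normal (slope p) (firsts r x')" using n \<pi> by (simp add: x'_def firsts_permute)
  have "{z \<in> orbit S_r r x'. normal (slope p) (firsts r z)} = orbit Young r x'"
  proof (intro equalityI subsetI)
    fix z assume "z \<in> {z \<in> orbit S_r r x'. normal (slope p) (firsts r z)}"
    then obtain \<tau> where \<tau>: "\<tau> permutes {..<r}" "z = permute r \<tau> x'"
      "normal (slope p) (permute r \<tau> (firsts r x'))"
      by (auto simp: orbit_permute firsts_permute)
    then show "z \<in> orbit Young r x'"
      using normal_permute_imp_Young[OF n'] by (auto simp: orbit_permute)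
  next
    fix z assume "z \<in> orbit Young r x'"
    then obtain \<tau> where \<tau>: "\<tau> \<in> Young" "z = permute r \<tau> x'" by (auto simp: orbit_permute)
    moreover have "\<tau> permutes {..<r}" using \<tau> Young.perms by blast
    moreover from this have "firsts r z = firsts r x'"
      using permute_Young_normal[OF n' \<tau>(1) x'] \<tau> by (simp add: firsts_permute)
    ultimately show "z \<in> {z \<in> orbit S_r r x'. normal (slope p) (firsts r z)}"
      using n' by (auto simp: orbit_permute)
  qed
  then have "fibre_coordinate p (orbit S_r r x') = seconds r ` orbit Young r x'"
    by (simp add: fibre_coordinate_def)
  also have "\<dots> = orbit Young r (seconds r x')"
    unfolding orbit_permute image_image
    by (intro image_cong refl) (simp add: seconds_permute Young.perms)
  finally show ?thesis
    using \<pi> Symmetric.orbit_permute_eq[OF \<pi>, of x] by (simp add: x'_def seconds_permute)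
qed

lemma trivialisation_orbit:
  assumes "x \<in> {..<r} \<rightarrow>\<^sub>E unit_circle \<times> unit_circle" "\<pi> \<in> S_r"
    "normal (slope p) (permute r \<pi> (firsts r x))"
  shows "trivialisation p (orbit S_r r x) =
    (orbit S_r r (firsts r x), orbit Young r (permute r \<pi> (seconds r x)))"
  using fibre_coordinate_orbit[OF assms] by (simp add: trivialisation_def forget_orbit)

lemma assemble_orbit:
  assumes l: "l \<in> {..<r} \<rightarrow>\<^sub>E unit_circle" and \<pi>: "\<pi> \<in> S_r"
    and n: "normal (slope p) (permute r \<pi> l)" and m: "m \<in> {..<r} \<rightarrow>\<^sub>E unit_circle"
  shows "assemble p (orbit S_r r l, orbit Young r m) = orbit S_r r (pair_up r (permute r \<pi> l) m)"
proof -
  define l' where "l' = permute r \<pi> l"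
  have l': "l' \<in> {..<r} \<rightarrow>\<^sub>E unit_circle" and n': "normal (slope p) l'"
    using l \<pi> n by (simp_all add: l'_def permute_PiE)
  have orb: "orbit S_r r l = orbit S_r r l'"
    unfolding l'_def by (rule Symmetric.orbit_permute_eq[OF \<pi>, symmetric])
  have single: "{k \<in> orbit S_r r l. normal (slope p) k} = {l'}"
  proof (intro equalityI subsetI)
    fix k assume "k \<in> {k \<in> orbit S_r r l. normal (slope p) k}"
    then obtain \<tau> where \<tau>: "\<tau> permutes {..<r}" "k = permute r \<tau> l'" "normal (slope p) (permute r \<tau> l')"
      unfolding orb by (auto simp: orbit_permute)
    then show "k \<in> {l'}"
      using permute_Young_normal[OF n' normal_permute_imp_Young[OF n' \<tau>(3,1)] l'] by simp
  qed (use n' Symmetric.orbit_refl[OF l'] orb in auto)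
  have "orbit S_r r (pair_up r l' m') = orbit S_r r (pair_up r l' m)" if m': "m' \<in> orbit Young r m" for m'
  proof -
    obtain \<nu> where \<nu>: "\<nu> \<in> Young" "m' = permute r \<nu> m"
      using m' unfolding orbit_permute by blast
    have "pair_up r l' m' = permute r \<nu> (pair_up r l' m)"
      using pair_up_permute[OF Young.perms[OF \<nu>(1)], of l' m] permute_Young_normal[OF n' \<nu>(1) l'] \<nu>(2)
      by simp
    then show ?thesis using Symmetric.orbit_permute_eq[of \<nu> "pair_up r l' m"] Young.perms[OF \<nu>(1)] by simp
  qed
  moreover have "m \<in> orbit Young r m" using Young.orbit_refl[OF m] .
  ultimately have "(\<Union>m'\<in>orbit Young r m. orbit S_r r (pair_up r l' m')) = orbit S_r r (pair_up r l' m)"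
    by blast
  then show ?thesis unfolding assemble_def fst_conv snd_conv single l'_def[symmetric] by simp
qed

text \<open>
  The key to continuity: by \<open>normal_iff_weakly\<close>, normality is a closed condition on tuples of type
  \<open>\<sigma>\<close> avoiding \<open>p\<close>. Since finitely many such sets, for different \<open>\<pi>\<close>, cover \<open>avoiding p\<close>,
  continuity can be tested on each of them.
\<close>

lemma closedin_normal:
  assumes p: "p \<in> unit_circle" and \<pi>: "\<pi> permutes {..<r}"
  shows "closedin (subtopology circle_power (avoiding p))
    {l \<in> avoiding p. normal (slope p) (permute r \<pi> l)}"
proof -
  define X where "X = subtopology circle_power (avoiding p)"
  have top: "topspace X = avoiding p" by (auto simp: X_def avoiding_def)
  have c: "continuous_map X (top_of_set (unit_circle - {p})) (\<lambda>l. l (\<pi> j))" if "j < r" for j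
  proof -
    have j: "\<pi> j < r" using that \<pi> by (simp add: permutes_less)
    have "continuous_map circle_power (top_of_set unit_circle) (\<lambda>l. l (\<pi> j))"
      using continuous_map_product_projection[of "\<pi> j" "{..<r}" "\<lambda>_. top_of_set unit_circle"] j by simp
    then have "continuous_map X (top_of_set unit_circle) (\<lambda>l. l (\<pi> j))"
      unfolding X_def by (rule continuous_map_from_subtopology)
    then have "continuous_map X euclidean (\<lambda>l. l (\<pi> j))"
      by (simp add: continuous_map_in_subtopology)
    moreover have "(\<lambda>l. l (\<pi> j)) \<in> topspace X \<rightarrow> unit_circle - {p}"
      using j unfolding top avoiding_def by (auto simp: PiE_iff)
    ultimately show ?thesis by (simp add: continuous_map_in_subtopology)
  qed
  have eq: "closedin X {l \<in> topspace X. l (\<pi> j) = l (\<pi> j')}" if "j < r" "j' < r" for j j'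
  proof -
    have "continuous_map X euclidean (\<lambda>l. l (\<pi> j) - l (\<pi> j'))"
      using c[OF that(1)] c[OF that(2)]
      by (intro continuous_map_diff) (simp_all add: continuous_map_in_subtopology)
    from closedin_continuous_map_preimage[OF this, of "{0}"] show ?thesis by simp
  qed
  have le: "closedin X {l \<in> topspace X. slope p (l (\<pi> j)) \<le> slope p (l (\<pi> j'))}"
    if "j < r" "j' < r" for j j'
  proof -
    have sl: "continuous_map X euclidean (\<lambda>l. slope p (l (\<pi> j)))" if "j < r" for j
      using continuous_map_compose[OF c[OF that], of euclidean "slope p"] continuous_on_slope[OF p]
      by (simp add: o_def)
    have "continuous_map X euclidean (\<lambda>l. slope p (l (\<pi> j)) - slope p (l (\<pi> j')))"
      using sl that by (intro continuous_map_diff) auto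
    from closedin_continuous_map_preimage[OF this, of "{..0}"] show ?thesis by simp
  qed
  have eqv: "normal (slope p) (permute r \<pi> l) \<longleftrightarrow> (\<forall>j\<in>{..<r}. \<forall>j'\<in>{..<r}.
      (lab j = lab j' \<longrightarrow> l (\<pi> j) = l (\<pi> j')) \<and>
      (fst (lab j) = fst (lab j') \<and> snd (lab j) < snd (lab j') \<longrightarrow> slope p (l (\<pi> j)) \<le> slope p (l (\<pi> j'))))"
    if "l \<in> avoiding p" for l
  proof -
    have l: "permute r \<pi> l \<in> avoiding p" using avoiding_permute[OF \<pi> that] .
    then have "coincidences_given_by r s a \<rho> (permute r \<pi> l)" by (simp add: avoiding_def)
    from normal_iff_weakly[OF this slope_inj_avoiding[OF p l]] show ?thesis
      by (simp add: permute_apply Ball_def)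
  qed
  have "{l \<in> avoiding p. normal (slope p) (permute r \<pi> l)} = {l \<in> topspace X. \<forall>j\<in>{..<r}. \<forall>j'\<in>{..<r}.
      (lab j = lab j' \<longrightarrow> l (\<pi> j) = l (\<pi> j')) \<and>
      (fst (lab j) = fst (lab j') \<and> snd (lab j) < snd (lab j') \<longrightarrow> slope p (l (\<pi> j)) \<le> slope p (l (\<pi> j')))}"
    unfolding top using eqv by (intro Collect_cong conj_cong refl)
  also have "closedin X \<dots>"
  proof (intro closedin_Collect_ball)
    fix j j' assume "j \<in> {..<r}" "j' \<in> {..<r}"
    then have j: "j < r" "j' < r" by auto
    show "closedin X {l \<in> topspace X. (lab j = lab j' \<longrightarrow> l (\<pi> j) = l (\<pi> j')) \<and>
        (fst (lab j) = fst (lab j') \<and> snd (lab j) < snd (lab j') \<longrightarrow>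
          slope p (l (\<pi> j)) \<le> slope p (l (\<pi> j')))}"
      by (rule closedin_Collect_conj; rule closedin_Collect_imp; rule eq[OF j] le[OF j])
  qed
  finally show ?thesis by (simp add: X_def)
qed

end

section \<open>Closure properties of polynomials and of semialgebraic sets\<close>

lemma polynomials_diff:
  assumes "f \<in> polynomials C" "g \<in> polynomials C"
  shows "(\<lambda>x. f x - g x) \<in> polynomials C"
  using polynomials.add[OF assms(1) polynomials.mult[OF polynomials.const[of "-1"] assms(2)]] by simp

lemma polynomials_prod:
  "finite J \<Longrightarrow> (\<And>j. j \<in> J \<Longrightarrow> f j \<in> polynomials C) \<Longrightarrow> (\<lambda>x. \<Prod>j\<in>J. f j x) \<in> polynomials C"
  by (induction J rule: finite_induct) (auto intro: polynomials.const polynomials.mult)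

text \<open>
  The conditions on points of the circle are equations between complex numbers; each stands for two
  real polynomial equations.
\<close>

definition complex_polynomials :: "('t \<Rightarrow> real) set \<Rightarrow> ('t \<Rightarrow> complex) set" where
  "complex_polynomials C = {f. (\<lambda>x. Re (f x)) \<in> polynomials C \<and> (\<lambda>x. Im (f x)) \<in> polynomials C}"

lemma complex_polynomials_const: "(\<lambda>_. k) \<in> complex_polynomials C"
  by (simp add: complex_polynomials_def polynomials.const)

lemma complex_polynomials_mult:
  "f \<in> complex_polynomials C \<Longrightarrow> g \<in> complex_polynomials C \<Longrightarrow> (\<lambda>x. f x * g x) \<in> complex_polynomials C"
  by (simp add: complex_polynomials_def polynomials_diff polynomials.add polynomials.mult)

lemma complex_polynomials_prod:
  "finite J \<Longrightarrow> (\<And>j. j \<in> J \<Longrightarrow> f j \<in> complex_polynomials C) \<Longrightarrow>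
    (\<lambda>x. \<Prod>j\<in>J. f j x) \<in> complex_polynomials C"
  by (induction J rule: finite_induct) (auto intro: complex_polynomials_const complex_polynomials_mult)

lemma semialgebraic_not:
  assumes "{x \<in> W. P x} \<in> semialgebraic W C"
  shows "{x \<in> W. \<not> P x} \<in> semialgebraic W C"
proof -
  have "{x \<in> W. \<not> P x} = W - {x \<in> W. P x}" by blast
  then show ?thesis using semialgebraic.diff[OF assms] by (simp only:)
qed

lemma semialgebraic_conj:
  assumes "{x \<in> W. P x} \<in> semialgebraic W C" "{x \<in> W. Q x} \<in> semialgebraic W C"
  shows "{x \<in> W. P x \<and> Q x} \<in> semialgebraic W C"
proof -
  have "{x \<in> W. P x \<and> Q x} = {x \<in> W. P x} \<inter> {x \<in> W. Q x}" by blast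
  then show ?thesis using semialgebraic.inter[OF assms] by (simp only:)
qed

lemma semialgebraic_const: "{x \<in> W. b} \<in> semialgebraic W C"
  using semialgebraic.pos[OF polynomials.const[of "if b then 1 else 0"], of W C] by (cases b) simp_all

lemma semialgebraic_ball:
  "finite J \<Longrightarrow> (\<And>j. j \<in> J \<Longrightarrow> {x \<in> W. P j x} \<in> semialgebraic W C) \<Longrightarrow>
    {x \<in> W. \<forall>j\<in>J. P j x} \<in> semialgebraic W C"
proof (induction J rule: finite_induct)
  case empty
  show ?case using semialgebraic_const[of W True C] by simp
next
  case (insert i J)
  have "{x \<in> W. P i x \<and> (\<forall>j\<in>J. P j x)} \<in> semialgebraic W C"
    by (rule semialgebraic_conj) (use insert in auto)
  then show ?case by simp
qed

lemma semialgebraic_bex: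
  assumes "finite J" "\<And>j. j \<in> J \<Longrightarrow> {x \<in> W. P j x} \<in> semialgebraic W C"
  shows "{x \<in> W. \<exists>j\<in>J. P j x} \<in> semialgebraic W C"
proof -
  have "{x \<in> W. \<not> (\<forall>j\<in>J. \<not> P j x)} \<in> semialgebraic W C"
    by (rule semialgebraic_not, rule semialgebraic_ball[OF assms(1)], rule semialgebraic_not, rule assms(2))
  then show ?thesis by simp
qed

lemma semialgebraic_imp:
  assumes "b \<Longrightarrow> {x \<in> W. P x} \<in> semialgebraic W C"
  shows "{x \<in> W. b \<longrightarrow> P x} \<in> semialgebraic W C"
  using assms semialgebraic_const[of W True C] by (cases b) simp_all

lemma semialgebraic_iff:
  assumes "{x \<in> W. P x} \<in> semialgebraic W C"
  shows "{x \<in> W. b \<longleftrightarrow> P x} \<in> semialgebraic W C"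
  using assms semialgebraic_not[OF assms] by (cases b) simp_all

lemma semialgebraic_less:
  assumes "f \<in> polynomials C" "g \<in> polynomials C"
  shows "{x \<in> W. f x < g x} \<in> semialgebraic W C"
  using semialgebraic.pos[OF polynomials_diff[OF assms(2,1)], of W] by simp

lemma semialgebraic_complex_eq:
  assumes "f \<in> complex_polynomials C" "g \<in> complex_polynomials C"
  shows "{x \<in> W. f x = g x} \<in> semialgebraic W C"
proof -
  have eq: "{x \<in> W. h x = h' x} \<in> semialgebraic W C" if "h \<in> polynomials C" "h' \<in> polynomials C" for h h'
  proof -
    have "{x \<in> W. \<not> h x < h' x \<and> \<not> h' x < h x} \<in> semialgebraic W C"
      by (intro semialgebraic_conj semialgebraic_not semialgebraic_less that)
    also have "{x \<in> W. \<not> h x < h' x \<and> \<not> h' x < h x} = {x \<in> W. h x = h' x}" by auto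
    finally show ?thesis .
  qed
  show ?thesis
    unfolding complex_eq_iff
    by (rule semialgebraic_conj; rule eq) (use assms in \<open>auto simp: complex_polynomials_def\<close>)
qed

section \<open>The trivialisation is a semialgebraic homeomorphism\<close>

context block_labelling
begin

lemma euclidean_circle: "euclidean_top (SSym_circle r s a \<rho>) =
    subtopology (quotient_topology circle_power (orbit S_r r)) (points (SSym_circle r s a \<rho>))"
  and euclidean_torus: "euclidean_top (SSym_torus r s a \<rho>) =
    subtopology (quotient_topology torus_power (orbit S_r r)) (points (SSym_torus r s a \<rho>))"
  and euclidean_fibre: "euclidean_top (SSym_fibre r s a \<rho>) =
    subtopology (quotient_topology circle_power (orbit Young r)) (points (SSym_fibre r s a \<rho>))"
  by (simp_all add: euclidean_top_def SSym_circle_def SSym_torus_def SSym_fibre_def Sym_def)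

lemma continuous_forget:
  "continuous_map (euclidean_top (SSym_torus r s a \<rho>)) (euclidean_top (SSym_circle r s a \<rho>)) (forget_snd r)"
proof -
  have "continuous_map (quotient_topology torus_power (orbit S_r r))
      (quotient_topology circle_power (orbit S_r r)) (forget_snd r)"
  proof (rule continuous_compose_quotient_map[OF quotient_map_quotient_topology])
    show "continuous_map torus_power (quotient_topology circle_power (orbit S_r r))
        (forget_snd r \<circ> orbit S_r r)"
      using continuous_orbit[OF continuous_map_firsts] by (simp add: o_def forget_orbit)
  qed
  then show ?thesis
    unfolding euclidean_circle euclidean_torus
    by (intro continuous_map_into_subtopology continuous_map_from_subtopology)
      (auto simp: forget_mem_points)
qed

abbreviation torus_over :: "complex \<Rightarrow> (nat \<Rightarrow> complex \<times> complex) set topology" where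
  "torus_over p \<equiv> subtopology (quotient_topology torus_power (orbit S_r r)) (orbit S_r r ` lifts p)"

abbreviation chart_top :: "complex \<Rightarrow> (nat \<Rightarrow> complex) set topology" where
  "chart_top p \<equiv> subtopology (quotient_topology circle_power (orbit S_r r)) (chart p)"

lemma open_quotient_lifts:
  "open_quotient (subtopology torus_power (lifts p)) (torus_over p) (orbit S_r r)"
proof -
  have "{x \<in> topspace torus_power. orbit S_r r x \<in> orbit S_r r ` lifts p} = lifts p"
    using orbit_mem_over_chart[of _ p] by (auto simp only: topspace_product_topology topspace_euclidean_subtopology lifts_def)
  then show ?thesis
    using open_quotient_restriction[OF Symmetric.open_quotient_orbit, of "top_of_set (unit_circle \<times> unit_circle)"
        "orbit S_r r ` lifts p"] by simp
qed

lemma open_quotient_chart: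
  "open_quotient (subtopology circle_power (avoiding p)) (chart_top p) (orbit S_r r)"
proof -
  have "{x \<in> topspace circle_power. orbit S_r r x \<in> chart p} = avoiding p"
    using orbit_mem_chart[of _ p] by (auto simp only: topspace_product_topology topspace_euclidean_subtopology avoiding_def)
  then show ?thesis
    using open_quotient_restriction[OF Symmetric.open_quotient_orbit, of "top_of_set unit_circle" "chart p"] by simp
qed

lemma open_quotient_fibre:
  "open_quotient (subtopology circle_power unimodular) (euclidean_top (SSym_fibre r s a \<rho>)) (orbit Young r)"
proof -
  have "{x \<in> topspace circle_power. orbit Young r x \<in> points (SSym_fibre r s a \<rho>)} = unimodular"
    using orbit_mem_points_fibre by (auto simp only: topspace_product_topology topspace_euclidean_subtopology unimodular_def)
  then show ?thesis
    unfolding euclidean_fibre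
    using open_quotient_restriction[OF Young.open_quotient_orbit, of "top_of_set unit_circle"
        "points (SSym_fibre r s a \<rho>)"] by simp
qed

lemma topspace_lifts: "topspace (subtopology torus_power (lifts p)) = lifts p"
  and topspace_avoiding: "topspace (subtopology circle_power (avoiding p)) = avoiding p"
  and topspace_unimodular: "topspace (subtopology circle_power unimodular) = unimodular"
  by (auto simp: lifts_def avoiding_def unimodular_def)

text \<open>
  On the closed set of lifts that \<open>\<pi>\<close> brings into normal form, the trivialisation is induced by the
  continuous map that forgets the second components, respectively permutes them by \<open>\<pi>\<close>.
\<close>

lemma continuous_trivialisation:
  assumes p: "p \<in> unit_circle"
  shows "continuous_map (torus_over p)
    (prod_topology (chart_top p) (euclidean_top (SSym_fibre r s a \<rho>))) (trivialisation p)"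
proof (rule continuous_map_from_quotient_piecewise[OF open_quotient_imp_quotient_map[OF open_quotient_lifts] Symmetric.finite_group])
  fix \<pi> assume \<pi>: "\<pi> \<in> S_r"
  let ?C = "\<lambda>\<pi>. {x \<in> lifts p. normal (slope p) (permute r \<pi> (firsts r x))}"
  let ?L = "subtopology torus_power (lifts p)"
  have cf: "continuous_map ?L (subtopology circle_power (avoiding p)) (firsts r)"
    using continuous_map_from_subtopology[OF continuous_map_firsts]
    by (rule continuous_map_into_subtopology) (simp add: topspace_lifts lifts_def)
  have "?C \<pi> = {x \<in> topspace ?L. firsts r x \<in> {l \<in> avoiding p. normal (slope p) (permute r \<pi> l)}}"
    unfolding topspace_lifts by (auto simp only: lifts_def)
  then show "closedin ?L (?C \<pi>)"
    using closedin_continuous_map_preimage[OF cf closedin_normal[OF p]] \<pi> by simp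
  have cs: "continuous_map ?L (subtopology circle_power unimodular) (\<lambda>x. permute r \<pi> (seconds r x))"
  proof (rule continuous_map_into_subtopology)
    show "continuous_map ?L circle_power (\<lambda>x. permute r \<pi> (seconds r x))"
      using continuous_map_compose[OF continuous_map_from_subtopology[OF continuous_map_seconds] continuous_map_permute] \<pi>
      by (simp add: o_def)
    have "seconds r x \<in> unimodular" if "x \<in> lifts p" for x
      using that seconds_PiE[of x r unit_circle unit_circle] by (simp add: lifts_def unimodular_def)
    then show "(\<lambda>x. permute r \<pi> (seconds r x)) \<in> topspace ?L \<rightarrow> unimodular"
      using \<pi> unimodular_permute unfolding topspace_lifts by blast
  qed
  have "continuous_map ?L (chart_top p) (\<lambda>x. orbit S_r r (firsts r x))"
    by (rule continuous_map_open_quotient_compose[OF open_quotient_chart cf])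
  moreover have "continuous_map ?L (euclidean_top (SSym_fibre r s a \<rho>)) (\<lambda>x. orbit Young r (permute r \<pi> (seconds r x)))"
    by (rule continuous_map_open_quotient_compose[OF open_quotient_fibre cs])
  ultimately show "continuous_map (subtopology ?L (?C \<pi>)) (prod_topology (chart_top p) (euclidean_top (SSym_fibre r s a \<rho>)))
      (\<lambda>x. (orbit S_r r (firsts r x), orbit Young r (permute r \<pi> (seconds r x))))"
    by (rule continuous_map_from_subtopology[OF continuous_map_pairedI])
  show "trivialisation p (orbit S_r r x) = (orbit S_r r (firsts r x), orbit Young r (permute r \<pi> (seconds r x)))"
    if "x \<in> ?C \<pi>" for x
    by (rule trivialisation_orbit) (use that \<pi> in \<open>auto simp only: lifts_def\<close>)
next
  fix x assume "x \<in> topspace (subtopology torus_power (lifts p))"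
  then have x: "x \<in> lifts p" by (simp add: topspace_lifts)
  then have "firsts r x \<in> avoiding p" by (simp add: lifts_def)
  then show "\<exists>\<pi>\<in>S_r. x \<in> {x \<in> lifts p. normal (slope p) (permute r \<pi> (firsts r x))}"
    using ex_permute_normal_avoiding[OF p] x by blast
qed

lemma continuous_assemble:
  assumes p: "p \<in> unit_circle"
  shows "continuous_map (prod_topology (chart_top p) (euclidean_top (SSym_fibre r s a \<rho>)))
    (torus_over p) (assemble p)"
proof (rule continuous_map_from_quotient_piecewise[OF
      open_quotient_imp_quotient_map[OF open_quotient_map_prod[OF open_quotient_chart open_quotient_fibre]]
      Symmetric.finite_group])
  fix \<pi> assume \<pi>: "\<pi> \<in> S_r"
  let ?A = "subtopology circle_power (avoiding p)" and ?M = "subtopology circle_power unimodular"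
  let ?N = "{l \<in> avoiding p. normal (slope p) (permute r \<pi> l)}"
  let ?C = "\<lambda>\<pi>. {l \<in> avoiding p. normal (slope p) (permute r \<pi> l)} \<times> unimodular"
  have "closedin ?M unimodular" using closedin_topspace[of ?M] unfolding topspace_unimodular .
  then show "closedin (prod_topology ?A ?M) (?C \<pi>)"
    using closedin_normal[OF p] \<pi> by (simp add: closedin_prod_Times_iff)
  have l: "continuous_map (prod_topology ?A ?M) circle_power (\<lambda>z. permute r \<pi> (fst z))"
    using continuous_map_compose[OF continuous_map_into_fulltopology[OF continuous_map_fst] continuous_map_permute] \<pi>
    by (fastforce simp: o_def)
  have m: "continuous_map (prod_topology ?A ?M) circle_power snd"
    by (rule continuous_map_into_fulltopology[OF continuous_map_snd])
  have "continuous_map (prod_topology ?A ?M) (subtopology torus_power (lifts p))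
      (\<lambda>z. pair_up r (permute r \<pi> (fst z)) (snd z))"
  proof (rule continuous_map_into_subtopology[OF continuous_map_pair_up[OF l m]])
    have "pair_up r (permute r \<pi> l) m \<in> lifts p" if l: "l \<in> avoiding p" and m: "m \<in> unimodular" for l m
    proof -
      have l': "permute r \<pi> l \<in> avoiding p" using avoiding_permute l \<pi> by simp
      then have "permute r \<pi> l \<in> {..<r} \<rightarrow>\<^sub>E unit_circle" by (simp add: avoiding_def)
      moreover have "m \<in> {..<r} \<rightarrow>\<^sub>E unit_circle" using m by (simp add: unimodular_def)
      ultimately show ?thesis
        using l' m by (simp add: lifts_def pair_up_PiE firsts_pair_up seconds_pair_up unimodular_def)
    qed
    then show "(\<lambda>z. pair_up r (permute r \<pi> (fst z)) (snd z)) \<in> topspace (prod_topology ?A ?M) \<rightarrow> lifts p"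
      unfolding topspace_prod_topology topspace_avoiding topspace_unimodular by (simp add: Pi_iff mem_Times_iff)
  qed
  then have "continuous_map (prod_topology ?A ?M) (torus_over p)
      (\<lambda>z. orbit S_r r (pair_up r (permute r \<pi> (fst z)) (snd z)))"
    by (rule continuous_map_open_quotient_compose[OF open_quotient_lifts])
  then show "continuous_map (subtopology (prod_topology ?A ?M) (?C \<pi>)) (torus_over p)
      (\<lambda>z. orbit S_r r (pair_up r (permute r \<pi> (fst z)) (snd z)))"
    by (rule continuous_map_from_subtopology)
  show "assemble p (map_prod (orbit S_r r) (orbit Young r) z) = orbit S_r r (pair_up r (permute r \<pi> (fst z)) (snd z))"
    if "z \<in> ?C \<pi>" for z
    using that assemble_orbit[OF _ \<pi>, of "fst z" p "snd z"]
    by (simp add: map_prod_def split_beta mem_Times_iff avoiding_def unimodular_def)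
next
  fix z assume "z \<in> topspace (prod_topology (subtopology circle_power (avoiding p)) (subtopology circle_power unimodular))"
  then have "fst z \<in> avoiding p" "snd z \<in> unimodular"
    unfolding topspace_prod_topology topspace_avoiding topspace_unimodular by auto
  then show "\<exists>\<pi>\<in>S_r. z \<in> {l \<in> avoiding p. normal (slope p) (permute r \<pi> l)} \<times> unimodular"
    using ex_permute_normal_avoiding[OF p, of "fst z"] by (simp add: mem_Times_iff)
qed

lemma assemble_trivialisation:
  assumes p: "p \<in> unit_circle" and e: "e \<in> orbit S_r r ` lifts p"
  shows "assemble p (trivialisation p e) = e"
proof -
  obtain x where x: "x \<in> lifts p" "e = orbit S_r r x" using e by blast
  have xP: "x \<in> {..<r} \<rightarrow>\<^sub>E unit_circle \<times> unit_circle" and "firsts r x \<in> avoiding p"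
    using x by (simp_all add: lifts_def)
  then obtain \<pi> where \<pi>: "\<pi> \<in> S_r" and n: "normal (slope p) (permute r \<pi> (firsts r x))"
    using ex_permute_normal_avoiding[OF p] by blast
  have "assemble p (trivialisation p e) =
      orbit S_r r (pair_up r (permute r \<pi> (firsts r x)) (permute r \<pi> (seconds r x)))"
    unfolding x(2) trivialisation_orbit[OF xP \<pi> n]
    using \<pi> by (intro assemble_orbit[OF firsts_PiE[OF xP] \<pi> n] permute_PiE seconds_PiE[OF xP]) simp
  also have "\<dots> = orbit S_r r (permute r \<pi> x)"
    using \<pi> pair_up_firsts_seconds[OF xP] by (simp add: pair_up_permute)
  also have "\<dots> = e" unfolding x(2) by (rule Symmetric.orbit_permute_eq[OF \<pi>])
  finally show ?thesis .
qed

lemma trivialisation_assemble: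
  assumes p: "p \<in> unit_circle" and c: "c \<in> chart p" and d: "d \<in> points (SSym_fibre r s a \<rho>)"
  shows "trivialisation p (assemble p (c, d)) = (c, d)"
proof -
  obtain l m where l: "l \<in> avoiding p" "c = orbit S_r r l" and m: "m \<in> unimodular" "d = orbit Young r m"
    using c d unfolding chart_def points_fibre by blast
  obtain \<pi> where \<pi>: "\<pi> \<in> S_r" and n: "normal (slope p) (permute r \<pi> l)"
    using ex_permute_normal_avoiding[OF p l(1)] by blast
  have lP: "l \<in> {..<r} \<rightarrow>\<^sub>E unit_circle" and mP: "m \<in> {..<r} \<rightarrow>\<^sub>E unit_circle"
    using l m by (simp_all add: avoiding_def unimodular_def)
  define l' where "l' = permute r \<pi> l"
  have l'P: "l' \<in> {..<r} \<rightarrow>\<^sub>E unit_circle" using permute_PiE[OF _ lP] \<pi> by (simp add: l'_def)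
  have zP: "pair_up r l' m \<in> {..<r} \<rightarrow>\<^sub>E unit_circle \<times> unit_circle" by (rule pair_up_PiE[OF l'P mP])
  \<comment> \<open>The representative is already in normal form, so that the identity serves as \<open>\<pi>\<close>.\<close>
  have "normal (slope p) (permute r id (firsts r (pair_up r l' m)))"
    using n by (simp add: firsts_pair_up[OF l'P] permute_id[OF l'P]) (simp add: l'_def)
  from trivialisation_orbit[OF zP Symmetric.id_mem this]
  have "trivialisation p (orbit S_r r (pair_up r l' m)) = (orbit S_r r l', orbit Young r m)"
    by (simp add: firsts_pair_up[OF l'P] seconds_pair_up[OF mP] permute_id[OF mP])
  moreover have "orbit S_r r l' = c"
    unfolding l'_def l(2) by (rule Symmetric.orbit_permute_eq[OF \<pi>])
  ultimately show ?thesis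
    unfolding l(2) m(2) assemble_orbit[OF lP \<pi> n mP] l'_def by simp
qed

lemma homeomorphic_trivialisation:
  assumes p: "p \<in> unit_circle"
  shows "homeomorphic_map (torus_over p)
    (prod_topology (chart_top p) (euclidean_top (SSym_fibre r s a \<rho>))) (trivialisation p)"
proof -
  have "homeomorphic_maps (torus_over p)
    (prod_topology (chart_top p) (euclidean_top (SSym_fibre r s a \<rho>))) (trivialisation p) (assemble p)"
    unfolding homeomorphic_maps_def
    using continuous_trivialisation[OF p] continuous_assemble[OF p]
      assemble_trivialisation[OF p] trivialisation_assemble[OF p]
    by (auto simp: euclidean_fibre)
  then show ?thesis by (simp add: homeomorphic_maps_map)
qed

text \<open>
  The graph of the trivialisation upstairs: all choices of representatives are permutations, hence
  finite in number.
\<close>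

lemma orbit_trivialisation_eq_iff:
  assumes p: "p \<in> unit_circle"
    and x: "x \<in> {..<r} \<rightarrow>\<^sub>E unit_circle \<times> unit_circle"
    and y: "y \<in> {..<r} \<rightarrow>\<^sub>E unit_circle" and y': "y' \<in> {..<r} \<rightarrow>\<^sub>E unit_circle"
  shows "orbit S_r r x \<in> orbit S_r r ` lifts p \<and>
      trivialisation p (orbit S_r r x) = (orbit S_r r y, orbit Young r y') \<longleftrightarrow>
    x \<in> lifts p \<and> (\<exists>\<pi>\<in>S_r. normal (slope p) (permute r \<pi> (firsts r x)) \<and>
      (\<exists>\<tau>\<in>S_r. y = permute r \<tau> (firsts r x)) \<and> (\<exists>\<nu>\<in>Young. y' = permute r (\<pi> \<circ> \<nu>) (seconds r x)))"
    (is "?L \<longleftrightarrow> ?R")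
proof -
  have *: "trivialisation p (orbit S_r r x) = (orbit S_r r y, orbit Young r y') \<longleftrightarrow>
      (\<exists>\<tau>\<in>S_r. y = permute r \<tau> (firsts r x)) \<and> (\<exists>\<nu>\<in>Young. y' = permute r (\<pi> \<circ> \<nu>) (seconds r x))"
    if "\<pi> \<in> S_r" "normal (slope p) (permute r \<pi> (firsts r x))" for \<pi>
  proof -
    have "orbit S_r r y = orbit S_r r (firsts r x) \<longleftrightarrow> (\<exists>\<tau>\<in>S_r. y = permute r \<tau> (firsts r x))"
      by (rule Symmetric.orbit_eq_iff[OF y])
    moreover have "orbit Young r y' = orbit Young r (permute r \<pi> (seconds r x)) \<longleftrightarrow>
        (\<exists>\<nu>\<in>Young. y' = permute r \<nu> (permute r \<pi> (seconds r x)))"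
      by (rule Young.orbit_eq_iff[OF y'])
    ultimately show ?thesis
      unfolding trivialisation_orbit[OF x that] prod.inject
      by (metis permute_comp Young.perms)
  qed
  have lifts: "orbit S_r r x \<in> orbit S_r r ` lifts p \<longleftrightarrow> x \<in> lifts p"
    by (rule orbit_mem_over_chart[OF x])
  have "\<exists>\<pi>\<in>S_r. normal (slope p) (permute r \<pi> (firsts r x))" if "x \<in> lifts p"
    using ex_permute_normal_avoiding[OF p] that by (simp add: lifts_def)
  then show ?thesis unfolding lifts using * by blast
qed

lemma coords_torus_circle_fibre:
  fixes C
  defines "C \<equiv> coords (times_space (SSym_torus r s a \<rho>) (times_space (SSym_circle r s a \<rho>) (SSym_fibre r s a \<rho>)))"
  assumes j: "j < r"
  shows "(\<lambda>z. fst (fst z j)) \<in> complex_polynomials C" "(\<lambda>z. snd (fst z j)) \<in> complex_polynomials C"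
    "(\<lambda>z. fst (snd z) j) \<in> complex_polynomials C" "(\<lambda>z. snd (snd z) j) \<in> complex_polynomials C"
proof -
  have C: "C = (\<lambda>c. c \<circ> fst) ` {\<lambda>x. x j \<bullet> b |j b. j < r \<and> b \<in> Basis} \<union>
      (\<lambda>c. c \<circ> snd) ` ((\<lambda>c. c \<circ> fst) ` {\<lambda>x. x j \<bullet> b |j b. j < r \<and> b \<in> Basis} \<union>
        (\<lambda>c. c \<circ> snd) ` {\<lambda>x. x j \<bullet> b |j b. j < r \<and> b \<in> Basis})"
    by (simp add: C_def times_space_def SSym_torus_def SSym_circle_def SSym_fibre_def Sym_def)
  have 1: "(\<lambda>z. fst z j \<bullet> b) \<in> polynomials C" if "b \<in> Basis" for b
  proof -
    have "(\<lambda>x. x j \<bullet> b) \<circ> fst \<in> C" unfolding C using j that by blast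
    then show ?thesis using polynomials.coord by (fastforce simp: o_def)
  qed
  have 2: "(\<lambda>z. fst (snd z) j \<bullet> b) \<in> polynomials C" if "b \<in> Basis" for b
  proof -
    have "((\<lambda>x. x j \<bullet> b) \<circ> fst) \<circ> snd \<in> C" unfolding C using j that by blast
    then show ?thesis using polynomials.coord by (fastforce simp: o_def)
  qed
  have 3: "(\<lambda>z. snd (snd z) j \<bullet> b) \<in> polynomials C" if "b \<in> Basis" for b
  proof -
    have "((\<lambda>x. x j \<bullet> b) \<circ> snd) \<circ> snd \<in> C" unfolding C using j that by blast
    then show ?thesis using polynomials.coord by (fastforce simp: o_def)
  qed
  show "(\<lambda>z. fst (fst z j)) \<in> complex_polynomials C" "(\<lambda>z. snd (fst z j)) \<in> complex_polynomials C"
    using 1[of "(1, 0)"] 1[of "(\<i>, 0)"] 1[of "(0, 1)"] 1[of "(0, \<i>)"]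
    by (simp_all add: complex_polynomials_def inner_prod_def Basis_prod_def Basis_complex_def inner_complex_def)
  show "(\<lambda>z. fst (snd z) j) \<in> complex_polynomials C" "(\<lambda>z. snd (snd z) j) \<in> complex_polynomials C"
    using 2[of 1] 2[of \<i>] 3[of 1] 3[of \<i>]
    by (simp_all add: complex_polynomials_def Basis_complex_def inner_complex_def)
qed

text \<open>
  A tuple with a normal rearrangement automatically has type \<open>\<sigma>\<close>, so polynomial equations,
  inequations and inequalities suffice to describe the lifts.
\<close>

lemma lifts_normal_iff:
  assumes p: "p \<in> unit_circle" and \<pi>: "\<pi> \<in> S_r"
    and x: "x \<in> {..<r} \<rightarrow>\<^sub>E unit_circle \<times> unit_circle"
  shows "x \<in> lifts p \<and> normal (slope p) (permute r \<pi> (firsts r x)) \<longleftrightarrow>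
    (\<Prod>j\<in>{..<r}. fst (x j)) = 1 \<and> (\<Prod>j\<in>{..<r}. snd (x j)) = 1 \<and> (\<forall>j\<in>{..<r}. \<not> fst (x j) = p) \<and>
    (\<forall>j\<in>{..<r}. \<forall>j'\<in>{..<r}. (lab j = lab j' \<longleftrightarrow> fst (x (\<pi> j)) = fst (x (\<pi> j'))) \<and>
      (fst (lab j) = fst (lab j') \<and> snd (lab j) < snd (lab j') \<longrightarrow>
        Im (fst (x (\<pi> j)) * cnj p) * (1 - Re (fst (x (\<pi> j')) * cnj p)) <
        Im (fst (x (\<pi> j')) * cnj p) * (1 - Re (fst (x (\<pi> j)) * cnj p))))"
proof -
  have \<pi>j: "\<pi> j < r" if "j < r" for j using that \<pi> by (simp add: permutes_less)
  have circ: "fst (x j) \<in> unit_circle" if "j < r" for j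
    using PiE_mem[OF x, of j] that by (auto simp: mem_Times_iff)
  have "x \<in> lifts p \<and> normal (slope p) (permute r \<pi> (firsts r x)) \<longleftrightarrow>
      (\<Prod>j\<in>{..<r}. fst (x j)) = 1 \<and> (\<Prod>j\<in>{..<r}. snd (x j)) = 1 \<and> (\<forall>j\<in>{..<r}. \<not> fst (x j) = p) \<and>
      normal (slope p) (permute r \<pi> (firsts r x))"
  proof -
    have "coincidences_given_by r s a \<rho> (firsts r x)" if "normal (slope p) (permute r \<pi> (firsts r x))"
      using normal_imp_coincidences[OF that] \<pi> by (simp add: coincidences_permute)
    moreover have "p \<notin> firsts r x ` {..<r} \<longleftrightarrow> (\<forall>j\<in>{..<r}. \<not> fst (x j) = p)"
      by (auto simp: firsts_def)
    moreover have "(\<Prod>j<r. firsts r x j) = (\<Prod>j\<in>{..<r}. fst (x j))" "(\<Prod>j<r. seconds r x j) = (\<Prod>j\<in>{..<r}. snd (x j))"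
      by (simp_all add: firsts_def seconds_def)
    ultimately show ?thesis
      unfolding lifts_def avoiding_def mem_Collect_eq using x firsts_PiE[OF x] by metis
  qed
  also have "\<dots> \<longleftrightarrow> (\<Prod>j\<in>{..<r}. fst (x j)) = 1 \<and> (\<Prod>j\<in>{..<r}. snd (x j)) = 1 \<and> (\<forall>j\<in>{..<r}. \<not> fst (x j) = p) \<and>
    (\<forall>j\<in>{..<r}. \<forall>j'\<in>{..<r}. (lab j = lab j' \<longleftrightarrow> fst (x (\<pi> j)) = fst (x (\<pi> j'))) \<and>
      (fst (lab j) = fst (lab j') \<and> snd (lab j) < snd (lab j') \<longrightarrow>
        Im (fst (x (\<pi> j)) * cnj p) * (1 - Re (fst (x (\<pi> j')) * cnj p)) <
        Im (fst (x (\<pi> j')) * cnj p) * (1 - Re (fst (x (\<pi> j)) * cnj p))))"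
  proof (intro conj_cong refl)
    assume av: "\<forall>j\<in>{..<r}. \<not> fst (x j) = p"
    have val: "permute r \<pi> (firsts r x) j = fst (x (\<pi> j))" if "j < r" for j
      using that \<pi>j[OF that] by (simp add: permute_def firsts_def)
    have "slope p (fst (x (\<pi> j))) < slope p (fst (x (\<pi> j'))) \<longleftrightarrow>
        Im (fst (x (\<pi> j)) * cnj p) * (1 - Re (fst (x (\<pi> j')) * cnj p)) <
        Im (fst (x (\<pi> j')) * cnj p) * (1 - Re (fst (x (\<pi> j)) * cnj p))" if "j < r" "j' < r" for j j'
      by (rule slope_less_iff[OF p]) (use circ av \<pi>j that in auto)
    then show "normal (slope p) (permute r \<pi> (firsts r x)) \<longleftrightarrow>
      (\<forall>j\<in>{..<r}. \<forall>j'\<in>{..<r}. (lab j = lab j' \<longleftrightarrow> fst (x (\<pi> j)) = fst (x (\<pi> j'))) \<and>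
      (fst (lab j) = fst (lab j') \<and> snd (lab j) < snd (lab j') \<longrightarrow>
        Im (fst (x (\<pi> j)) * cnj p) * (1 - Re (fst (x (\<pi> j')) * cnj p)) <
        Im (fst (x (\<pi> j')) * cnj p) * (1 - Re (fst (x (\<pi> j)) * cnj p))))"
      by (simp add: normal_def Ball_def val del: times_complex.simps)
  qed
  finally show ?thesis .
qed

lemma semialgebraic_trivialisation:
  assumes p: "p \<in> unit_circle"
  shows "semialgebraic_map (SSym_torus r s a \<rho>) (times_space (SSym_circle r s a \<rho>) (SSym_fibre r s a \<rho>))
    (orbit S_r r ` lifts p) (trivialisation p)"
proof -
  define W where "W = topspace torus_power \<times> topspace (prod_topology circle_power circle_power)"
  define C where "C = coords (times_space (SSym_torus r s a \<rho>) (times_space (SSym_circle r s a \<rho>) (SSym_fibre r s a \<rho>)))"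
  have cls: "cls (SSym_torus r s a \<rho>) = orbit S_r r"
      "cls (times_space (SSym_circle r s a \<rho>) (SSym_fibre r s a \<rho>)) = map_prod (orbit S_r r) (orbit Young r)"
    and reps: "reps (SSym_torus r s a \<rho>) = torus_power"
      "reps (times_space (SSym_circle r s a \<rho>) (SSym_fibre r s a \<rho>)) = prod_topology circle_power circle_power"
    by (simp_all add: times_space_def SSym_torus_def SSym_circle_def SSym_fibre_def Sym_def)
  note coord = coords_torus_circle_fibre[folded C_def]
  \<comment> \<open>The condition that \<open>\<pi>\<close> brings the lift \<open>fst z\<close> into normal form, as in \<open>lifts_normal_iff\<close>.\<close>
  define N where "N \<pi> z \<longleftrightarrow>
    (\<Prod>j\<in>{..<r}. fst (fst z j)) = 1 \<and> (\<Prod>j\<in>{..<r}. snd (fst z j)) = 1 \<and> (\<forall>j\<in>{..<r}. \<not> fst (fst z j) = p) \<and>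
    (\<forall>j\<in>{..<r}. \<forall>j'\<in>{..<r}. (lab j = lab j' \<longleftrightarrow> fst (fst z (\<pi> j)) = fst (fst z (\<pi> j'))) \<and>
      (fst (lab j) = fst (lab j') \<and> snd (lab j) < snd (lab j') \<longrightarrow>
        Im (fst (fst z (\<pi> j)) * cnj p) * (1 - Re (fst (fst z (\<pi> j')) * cnj p)) <
        Im (fst (fst z (\<pi> j')) * cnj p) * (1 - Re (fst (fst z (\<pi> j)) * cnj p))))"
    for \<pi> and z :: "(nat \<Rightarrow> complex \<times> complex) \<times> (nat \<Rightarrow> complex) \<times> (nat \<Rightarrow> complex)"
  have saN: "{z \<in> W. N \<pi> z} \<in> semialgebraic W C" if \<pi>: "\<pi> \<in> S_r" for \<pi>
    unfolding N_def
  proof (rule semialgebraic_conj, goal_cases)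
    case 1 show ?case
      by (rule semialgebraic_complex_eq) (auto intro!: complex_polynomials_prod complex_polynomials_const coord)
  next
    case 2 show ?case
    proof (rule semialgebraic_conj, goal_cases)
      case 1 show ?case
        by (rule semialgebraic_complex_eq) (auto intro!: complex_polynomials_prod complex_polynomials_const coord)
    next
      case 2 show ?case
      proof (rule semialgebraic_conj, goal_cases)
        case 1 show ?case
          by (rule semialgebraic_ball, simp, rule semialgebraic_not, rule semialgebraic_complex_eq)
            (auto intro!: complex_polynomials_const coord)
      next
        case 2 show ?case
        proof (rule semialgebraic_ball, simp, rule semialgebraic_ball, simp)
          fix j j' assume "j \<in> {..<r}" "j' \<in> {..<r}"
          then have "\<pi> j < r" "\<pi> j' < r" using \<pi> by (simp_all add: permutes_less)
          note c = coord(1)[OF this(1)] coord(1)[OF this(2)]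
          note cp = c[THEN complex_polynomials_mult[OF _ complex_polynomials_const[of "cnj p"]]]
          have ReIm: "(\<lambda>z. Im (fst (fst z (\<pi> i)) * cnj p)) \<in> polynomials C"
            "(\<lambda>z. 1 - Re (fst (fst z (\<pi> i)) * cnj p)) \<in> polynomials C" if "i \<in> {j, j'}" for i
            using cp that unfolding complex_polynomials_def
            by (auto intro!: polynomials_diff polynomials.const simp del: times_complex.simps)
          show "{z \<in> W. (lab j = lab j' \<longleftrightarrow> fst (fst z (\<pi> j)) = fst (fst z (\<pi> j'))) \<and>
              (fst (lab j) = fst (lab j') \<and> snd (lab j) < snd (lab j') \<longrightarrow>
                Im (fst (fst z (\<pi> j)) * cnj p) * (1 - Re (fst (fst z (\<pi> j')) * cnj p)) <
                Im (fst (fst z (\<pi> j')) * cnj p) * (1 - Re (fst (fst z (\<pi> j)) * cnj p)))}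
              \<in> semialgebraic W C"
          proof (rule semialgebraic_conj, goal_cases)
            case 1 show ?case by (rule semialgebraic_iff, rule semialgebraic_complex_eq[OF c])
          next
            case 2 show ?case
              by (rule semialgebraic_imp, rule semialgebraic_less; rule polynomials.mult; rule ReIm; simp)
          qed
        qed
      qed
    qed
  qed
  have saG: "{z \<in> W. \<exists>\<pi>\<in>S_r. N \<pi> z \<and> (\<exists>\<tau>\<in>S_r. \<forall>j\<in>{..<r}. fst (snd z) j = fst (fst z (\<tau> j))) \<and>
      (\<exists>\<nu>\<in>Young. \<forall>j\<in>{..<r}. snd (snd z) j = snd (fst z ((\<pi> \<circ> \<nu>) j)))} \<in> semialgebraic W C"
  proof (rule semialgebraic_bex[OF Symmetric.finite_group], rule semialgebraic_conj[OF saN])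
    fix \<pi> assume \<pi>: "\<pi> \<in> S_r"
    show "{z \<in> W. (\<exists>\<tau>\<in>S_r. \<forall>j\<in>{..<r}. fst (snd z) j = fst (fst z (\<tau> j))) \<and>
      (\<exists>\<nu>\<in>Young. \<forall>j\<in>{..<r}. snd (snd z) j = snd (fst z ((\<pi> \<circ> \<nu>) j)))} \<in> semialgebraic W C"
    proof (rule semialgebraic_conj, goal_cases)
      case 1 show ?case
        by (rule semialgebraic_bex[OF Symmetric.finite_group], rule semialgebraic_ball, simp,
            rule semialgebraic_complex_eq; rule coord) (simp_all add: permutes_less)
    next
      case 2 show ?case
        by (rule semialgebraic_bex[OF Young.finite_group], rule semialgebraic_ball, simp,
            rule semialgebraic_complex_eq; rule coord)
          (use \<pi> in \<open>simp_all add: permutes_less Young.perms\<close>)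
    qed
  qed
  have "{(x, y). x \<in> topspace torus_power \<and> y \<in> topspace (prod_topology circle_power circle_power) \<and>
      orbit S_r r x \<in> orbit S_r r ` lifts p \<and>
      trivialisation p (orbit S_r r x) = map_prod (orbit S_r r) (orbit Young r) y} =
    {z \<in> W. \<exists>\<pi>\<in>S_r. N \<pi> z \<and> (\<exists>\<tau>\<in>S_r. \<forall>j\<in>{..<r}. fst (snd z) j = fst (fst z (\<tau> j))) \<and>
      (\<exists>\<nu>\<in>Young. \<forall>j\<in>{..<r}. snd (snd z) j = snd (fst z ((\<pi> \<circ> \<nu>) j)))}"
  proof (rule set_eqI)
    fix z :: "(nat \<Rightarrow> complex \<times> complex) \<times> (nat \<Rightarrow> complex) \<times> (nat \<Rightarrow> complex)"
    obtain x y y' where z: "z = (x, y, y')" by (metis prod.exhaust)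
    show "z \<in> {(x, y). x \<in> topspace torus_power \<and> y \<in> topspace (prod_topology circle_power circle_power) \<and>
        orbit S_r r x \<in> orbit S_r r ` lifts p \<and>
        trivialisation p (orbit S_r r x) = map_prod (orbit S_r r) (orbit Young r) y} \<longleftrightarrow>
      z \<in> {z \<in> W. \<exists>\<pi>\<in>S_r. N \<pi> z \<and> (\<exists>\<tau>\<in>S_r. \<forall>j\<in>{..<r}. fst (snd z) j = fst (fst z (\<tau> j))) \<and>
        (\<exists>\<nu>\<in>Young. \<forall>j\<in>{..<r}. snd (snd z) j = snd (fst z ((\<pi> \<circ> \<nu>) j)))}"
    proof (cases "z \<in> W")
      case False
      then show ?thesis unfolding W_def z by blast
    next
      case True
      then have x: "x \<in> {..<r} \<rightarrow>\<^sub>E unit_circle \<times> unit_circle" and y: "y \<in> {..<r} \<rightarrow>\<^sub>E unit_circle"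
        and y': "y' \<in> {..<r} \<rightarrow>\<^sub>E unit_circle"
        by (simp_all add: z W_def)
      have eq: "u = permute r \<tau> v \<longleftrightarrow> (\<forall>j\<in>{..<r}. u j = v (\<tau> j))"
        if "u \<in> {..<r} \<rightarrow>\<^sub>E unit_circle" for u v :: "nat \<Rightarrow> complex" and \<tau>
      proof
        assume *: "\<forall>j\<in>{..<r}. u j = v (\<tau> j)"
        show "u = permute r \<tau> v"
        proof
          fix j show "u j = permute r \<tau> v j"
            using * PiE_arb[OF that, of j] by (cases "j < r") (simp_all add: permute_def)
        qed
      qed (simp add: permute_apply)
      have fst: "(\<forall>j\<in>{..<r}. u j = firsts r x (\<tau> j)) \<longleftrightarrow> (\<forall>j\<in>{..<r}. u j = fst (x (\<tau> j)))"
        and snd: "(\<forall>j\<in>{..<r}. u j = seconds r x (\<tau> j)) \<longleftrightarrow> (\<forall>j\<in>{..<r}. u j = snd (x (\<tau> j)))"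
        if "\<tau> permutes {..<r}" for u \<tau>
        using that by (simp_all add: firsts_def seconds_def permutes_less)
      have "(x \<in> lifts p \<and> (\<exists>\<pi>\<in>S_r. normal (slope p) (permute r \<pi> (firsts r x)) \<and>
          (\<exists>\<tau>\<in>S_r. y = permute r \<tau> (firsts r x)) \<and> (\<exists>\<nu>\<in>Young. y' = permute r (\<pi> \<circ> \<nu>) (seconds r x)))) \<longleftrightarrow>
        (\<exists>\<pi>\<in>S_r. (x \<in> lifts p \<and> normal (slope p) (permute r \<pi> (firsts r x))) \<and>
          (\<exists>\<tau>\<in>S_r. y = permute r \<tau> (firsts r x)) \<and> (\<exists>\<nu>\<in>Young. y' = permute r (\<pi> \<circ> \<nu>) (seconds r x)))"
        by blast
      also have "\<dots> \<longleftrightarrow> (\<exists>\<pi>\<in>S_r. N \<pi> z \<and> (\<exists>\<tau>\<in>S_r. \<forall>j\<in>{..<r}. y j = fst (x (\<tau> j))) \<and>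
          (\<exists>\<nu>\<in>Young. \<forall>j\<in>{..<r}. y' j = snd (x ((\<pi> \<circ> \<nu>) j))))"
      proof (rule bex_cong[OF refl])
        fix \<pi> assume \<pi>: "\<pi> \<in> S_r"
        have 1: "x \<in> lifts p \<and> normal (slope p) (permute r \<pi> (firsts r x)) \<longleftrightarrow> N \<pi> z"
          unfolding lifts_normal_iff[OF p \<pi> x] N_def z fst_conv ..
        have 2: "(\<exists>\<tau>\<in>S_r. y = permute r \<tau> (firsts r x)) \<longleftrightarrow> (\<exists>\<tau>\<in>S_r. \<forall>j\<in>{..<r}. y j = fst (x (\<tau> j)))"
          unfolding eq[OF y] by (intro bex_cong refl fst) simp
        have 3: "(\<exists>\<nu>\<in>Young. y' = permute r (\<pi> \<circ> \<nu>) (seconds r x)) \<longleftrightarrow>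
            (\<exists>\<nu>\<in>Young. \<forall>j\<in>{..<r}. y' j = snd (x ((\<pi> \<circ> \<nu>) j)))"
          unfolding eq[OF y'] by (intro bex_cong refl snd permutes_compose[OF Young.perms]) (use \<pi> in simp_all)
        show "(x \<in> lifts p \<and> normal (slope p) (permute r \<pi> (firsts r x))) \<and>
          (\<exists>\<tau>\<in>S_r. y = permute r \<tau> (firsts r x)) \<and> (\<exists>\<nu>\<in>Young. y' = permute r (\<pi> \<circ> \<nu>) (seconds r x)) \<longleftrightarrow>
          N \<pi> z \<and> (\<exists>\<tau>\<in>S_r. \<forall>j\<in>{..<r}. y j = fst (x (\<tau> j))) \<and>
          (\<exists>\<nu>\<in>Young. \<forall>j\<in>{..<r}. y' j = snd (x ((\<pi> \<circ> \<nu>) j)))"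
          unfolding 1 2 3 ..
      qed
      finally show ?thesis
        using orbit_trivialisation_eq_iff[OF p x y y'] True x y y' by (simp add: z)
    qed
  qed
  then show ?thesis
    unfolding semialgebraic_map_def cls reps C_def[symmetric] W_def[symmetric] using saG by simp
qed

lemma zariski_open_chart: "openin (zariski_top (SSym_circle r s a \<rho>)) (chart p)"
proof -
  define Q where "Q = zariski_reps (SSym_circle r s a \<rho>)"
  define V where "V = {x \<in> {..<r} \<rightarrow>\<^sub>E unit_circle. p \<notin> x ` {..<r}}"
  define C where "C = coords (SSym_circle r s a \<rho>)"
  have top: "topspace (reps (SSym_circle r s a \<rho>)) = {..<r} \<rightarrow>\<^sub>E unit_circle"
    by (simp add: SSym_circle_def Sym_def)
  have topQ: "topspace Q = {..<r} \<rightarrow>\<^sub>E unit_circle"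
  proof
    show "{..<r} \<rightarrow>\<^sub>E unit_circle \<subseteq> topspace Q"
      using polynomials.const[of 1 C] unfolding Q_def zariski_reps_def C_def top[symmetric] by fastforce
  qed (auto simp: Q_def zariski_reps_def top)
  have c: "(\<lambda>x. x j \<bullet> b) \<in> polynomials C" if "j < r" "b \<in> Basis" for j and b :: complex
    by (rule polynomials.coord) (use that in \<open>auto simp: C_def SSym_circle_def Sym_def\<close>)
  \<comment> \<open>The square of the distance makes the condition of avoiding \<open>p\<close> a single real polynomial inequation.\<close>
  define f where "f x = (\<Prod>j\<in>{..<r}. (Re (x j) - Re p) * (Re (x j) - Re p) + (Im (x j) - Im p) * (Im (x j) - Im p))"
    for x :: "nat \<Rightarrow> complex"
  have "f \<in> polynomials C"
    unfolding f_def
    by (intro polynomials_prod polynomials.add polynomials.mult polynomials_diff polynomials.const)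
      (use c[of _ 1] c[of _ \<i>] in \<open>simp_all add: inner_complex_def Basis_complex_def\<close>)
  moreover have "V = {x \<in> {..<r} \<rightarrow>\<^sub>E unit_circle. f x \<noteq> 0}"
    by (auto simp: V_def f_def sum_squares_eq_zero_iff complex_eq_iff) (metis complex_eqI imageI lessThan_iff)
  ultimately have "openin Q V"
    unfolding Q_def zariski_reps_def top
    by (intro topology_generated_by_Basis) (auto simp: C_def)
  moreover have "{x \<in> topspace Q. orbit S_r r x \<in> orbit S_r r ` V} = V"
  proof -
    have "orbit S_r r x \<in> orbit S_r r ` V \<longleftrightarrow> x \<in> V" if "x \<in> {..<r} \<rightarrow>\<^sub>E unit_circle" for x
      by (rule orbit_mem_iff[OF perm_group_symmetric _ that]) (simp add: V_def permute_PiE image_permute)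
    then show ?thesis unfolding topQ by (auto simp only: V_def)
  qed
  moreover have "orbit S_r r ` V \<subseteq> orbit S_r r ` topspace Q"
    unfolding topQ by (rule image_mono) (auto simp: V_def)
  ultimately have "openin (quotient_topology Q (orbit S_r r)) (orbit S_r r ` V)"
    by (simp add: openin_quotient_topology)
  moreover have "chart p = orbit S_r r ` V \<inter> points (SSym_circle r s a \<rho>)"
  proof (intro equalityI subsetI)
    fix c assume "c \<in> orbit S_r r ` V \<inter> points (SSym_circle r s a \<rho>)"
    then obtain x where x: "x \<in> V" "c = orbit S_r r x" "orbit S_r r x \<in> points (SSym_circle r s a \<rho>)" by blast
    moreover have "x \<in> {..<r} \<rightarrow>\<^sub>E unit_circle" using x by (simp add: V_def)
    ultimately have "x \<in> avoiding p" using orbit_mem_points_circle by (simp add: avoiding_def V_def)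
    then show "c \<in> chart p" using x by (simp add: chart_def)
  next
    fix c assume c: "c \<in> chart p"
    moreover have "avoiding p \<subseteq> V" unfolding avoiding_def V_def by blast
    ultimately have "c \<in> orbit S_r r ` V" unfolding chart_def by blast
    then show "c \<in> orbit S_r r ` V \<inter> points (SSym_circle r s a \<rho>)" using c chart_subset by blast
  qed
  moreover have "cls (SSym_circle r s a \<rho>) = orbit S_r r" by (simp add: SSym_circle_def Sym_def)
  ultimately show ?thesis
    unfolding zariski_top_def openin_subtopology Q_def by auto
qed

lemma charts_cover:
  assumes "b \<in> points (SSym_circle r s a \<rho>)"
  shows "\<exists>p\<in>unit_circle. b \<in> chart p"
proof -
  obtain x where x: "b = orbit S_r r x" "x \<in> {..<r} \<rightarrow>\<^sub>E unit_circle" "(\<Prod>j<r. x j) = 1"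
    "coincidences_given_by r s a \<rho> x"
    using assms unfolding points_circle by blast
  have "infinite unit_circle"
  proof
    assume "finite unit_circle"
    moreover have "connected unit_circle" by (rule connected_sphere) simp
    ultimately obtain z where "unit_circle = {z}"
      using connected_finite_iff_sing by (metis insert_not_empty norm_one dist_0_norm mem_sphere emptyE)
    moreover have "1 \<in> unit_circle" "-1 \<in> unit_circle" by auto
    ultimately show False by (metis singletonD one_neq_neg_one)
  qed
  then have "\<not> unit_circle \<subseteq> x ` {..<r}" using finite_subset by blast
  then obtain p where "p \<in> unit_circle" "p \<notin> x ` {..<r}" by blast
  then show ?thesis using x by (auto simp only: chart_def avoiding_def)
qed

theorem locally_trivial:
  "zariski_locally_trivial
     (SSym_torus r s a \<rho>) (SSym_circle r s a \<rho>) (SSym_fibre r s a \<rho>) (forget_snd r)"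
  unfolding zariski_locally_trivial_def
proof (intro conjI ballI continuous_forget)
  fix b assume "b \<in> points (SSym_circle r s a \<rho>)"
  then obtain p where p: "p \<in> unit_circle" "b \<in> chart p" using charts_cover by blast
  have "orbit S_r r ` lifts p \<subseteq> points (SSym_torus r s a \<rho>)"
    using points_over_chart[of p] by blast
  then have tops: "subtopology (euclidean_top (SSym_torus r s a \<rho>)) (orbit S_r r ` lifts p) = torus_over p"
    "subtopology (euclidean_top (SSym_circle r s a \<rho>)) (chart p) = chart_top p"
    using chart_subset[of p]
    by (simp_all add: euclidean_torus euclidean_circle subtopology_subtopology Int_absorb1)
  show "\<exists>U \<phi>. openin (zariski_top (SSym_circle r s a \<rho>)) U \<and> b \<in> U \<and>
     (let D = {e \<in> points (SSym_torus r s a \<rho>). forget_snd r e \<in> U} in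
        homeomorphic_map (subtopology (euclidean_top (SSym_torus r s a \<rho>)) D)
          (prod_topology (subtopology (euclidean_top (SSym_circle r s a \<rho>)) U)
            (euclidean_top (SSym_fibre r s a \<rho>))) \<phi> \<and>
        semialgebraic_map (SSym_torus r s a \<rho>)
          (times_space (SSym_circle r s a \<rho>) (SSym_fibre r s a \<rho>)) D \<phi> \<and>
        (\<forall>e\<in>D. fst (\<phi> e) = forget_snd r e))"
    by (intro exI[of _ "chart p"] exI[of _ "trivialisation p"], unfold Let_def points_over_chart tops)
      (use p zariski_open_chart homeomorphic_trivialisation semialgebraic_trivialisation
        in \<open>simp add: trivialisation_def\<close>)
qed

end

theorem proposition2p14:
  fixes r s :: nat and a \<rho> :: "nat \<Rightarrow> nat"
  assumes "r \<ge> 1" and "partition_type r s a \<rho>"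
  shows "zariski_locally_trivial
           (SSym_torus r s a \<rho>) (SSym_circle r s a \<rho>) (SSym_fibre r s a \<rho>) (forget_snd r)"
proof -
  obtain lab where "block_labelling r s a \<rho> lab" using ex_block_labelling[OF assms(2)] by blast
  then show ?thesis by (rule block_labelling.locally_trivial)
qed

end
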